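(* Let $(X,d)$ be a separable, directionally limited metric space endowed with an asymptotically $(\alpha,\gamma)$-bounded measure $\nu$, for some constants $\alpha\in(0,1]$ and $\gamma\ge1$. Let $\mu=\mu^+-\mu^-$ be a locally finite, Borel-regular signed measure on $X$. Let $q_+,q_-$ be premeasures defined on the closed balls of $X$ such that, for some $C\ge1$ (and with the same $\alpha$), for all $x\in X$ and $r>0$, $$\frac1C\,\mu^+(B_{\alpha r}(x))-\mu^-(B_r(x))\le q_+(B_r(x))\le C\,\mu^+(B_r(x)),$$ $$\frac1C\,\mu^-(B_{\alpha r}(x))-\mu^+(B_r(x))\le q_-(B_r(x))\le C\,\mu^-(B_r(x)).$$ Let $\hat\mu^{q_+},\hat\mu^{q_-}$ be obtained from $q_+,q_-$ by the packing construction. Then: (i) $\hat\mu^{q_+}$ and $\hat\mu^{q_-}$ are metric outer measures, finite on bounded sets; (ii) $\hat\mu^q=\hat\mu^{q_+}-\hat\mu^{q_-}$ is a signed measure such that, for every Borel set $A\subset X$, $$\frac1{\gamma C}\mu^+(A)\le\hat\mu^{q_+}(A)\le C\mu^+(A)\quad\text{and}\quad\frac1{\gamma C}\mu^-(A)\le\hat\mu^{q_-}(A)\le C\mu^-(A),$$ whence in particular $$\frac1{\gamma C}|\mu|(A)\le|\hat\mu^q|(A)\le C|\mu|(A).$$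
   Context: Balls: $B_r(x)=\{y\in X: d(x,y)\le r\}$ is the closed ball and $U_r(x)=\{y\in X: d(x,y)<r\}$ the open ball, $r>0$. A Borel signed measure is a countably additive set function $\mu:\mathcal B(X)\to[-\infty,+\infty]$ with $\mu(\emptyset)=0$, where $\mathcal B(X)$ is the Borel $\sigma$-algebra; $\mu=\mu^+-\mu^-$ is its Hahn (Jordan) decomposition into mutually singular nonnegative measures, at least one of which is finite; $|\mu|=\mu^++\mu^-$. Directionally limited: let $\xi>0$, $0<\eta\le\frac13$, $\zeta\in\{1,2,\dots\}$ and $A\subset X$. The distance $d$ is directionally $(\xi,\eta,\zeta)$-limited at $A$ if, for every $a\in A$ and every $B\subset A\cap(U_\xi(a)\setminus\{a\})$ with the property that for all $b,c\in B$ with $b\ne c$ and $d(a,b)\ge d(a,c)$ and all $x\in X$ with $d(a,x)=d(a,c)$ and $d(a,x)+d(x,b)=d(a,b)$ one has $\frac{d(x,c)}{d(a,c)}\ge\eta$, it holds that $\operatorname{card}B\le\zeta$. $(X,d)$ is directionally limited if $d$ is directionally $(\xi,\eta,\zeta)$-limited at $X$ for some such $(\xi,\eta,\zeta)$. Asymptotically $(\alpha,\gamma)$-bounded measure: a positive Borel measure $\nu$ on $X$ that is finite on bounded sets, strictly positive on every ball of positive radius, and such that $\limsup_{r\to0^+}\frac{\nu(B_r(x))}{\nu(B_{\alpha r}(x))}\le\gamma$ for all $x\in X$. Premeasure: a nonnegative function $q$ defined on the family of closed balls of $X$ together with $\emptyset$, with $q(\emptyset)=0$. Packing construction: for $U\subset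 X$ open and $\delta>0$, a packing of $U$ of order $\delta$ is a countable family of pairwise disjoint closed balls of radius less than $\delta$ whose union is contained in $U$. Set $\hat\mu^q_\delta(U)=\sup\{\sum_{B\in\mathcal F}q(B): \mathcal F\text{ is a packing of }U\text{ of order }\delta\}$, $\hat\mu^q(U)=\lim_{\delta\to0}\hat\mu^q_\delta(U)=\inf_{\delta>0}\hat\mu^q_\delta(U)$ for $U$ open, and $\hat\mu^q(A)=\inf\{\hat\mu^q(U): A\subset U,\ U\text{ open}\}$ for every $A\subset X$. An outer measure is a metric outer measure if it is additive on pairs $E,F\subset X$ with $d(E,F)>0$. *)

theory Defs
  imports "HOL-Analysis.Analysis"
begin

subsection \<open>Directionally limited metric spaces and asymptotically bounded measures\<close>

definition directionally_limited_at ::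
  "real \<Rightarrow> real \<Rightarrow> nat \<Rightarrow> 'a::metric_space set \<Rightarrow> bool" where
  "directionally_limited_at \<xi> \<eta> \<zeta> A \<longleftrightarrow>
     (\<forall>a\<in>A. \<forall>B. B \<subseteq> A \<inter> (ball a \<xi> - {a}) \<longrightarrow>
        (\<forall>b\<in>B. \<forall>c\<in>B. b \<noteq> c \<and> dist a b \<ge> dist a c \<longrightarrow>
           (\<forall>x. dist a x = dist a c \<and> dist a x + dist x b = dist a b \<longrightarrow>
                dist x c / dist a c \<ge> \<eta>)) \<longrightarrow>
        finite B \<and> card B \<le> \<zeta>)"

definition directionally_limited :: "'a::metric_space itself \<Rightarrow> bool" where
  "directionally_limited _ \<longleftrightarrow>
     (\<exists>\<xi> \<eta> \<zeta>. \<xi> > 0 \<and> 0 < \<eta> \<and> \<eta> \<le> 1/3 \<and> \<zeta> \<ge> 1 \<and>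
        directionally_limited_at \<xi> \<eta> \<zeta> (UNIV :: 'a set))"

definition asymptotically_bounded ::
  "real \<Rightarrow> real \<Rightarrow> 'a::metric_space measure \<Rightarrow> bool" where
  "asymptotically_bounded \<alpha> \<gamma> \<nu> \<longleftrightarrow>
     sets \<nu> = sets borel \<and>
     (\<forall>A\<in>sets borel. bounded A \<longrightarrow> emeasure \<nu> A < \<infinity>) \<and>
     (\<forall>x. \<forall>r>0. emeasure \<nu> (cball x r) > 0) \<and>
     (\<forall>x. Limsup (at_right 0)
            (\<lambda>r. emeasure \<nu> (cball x r) / emeasure \<nu> (cball x (\<alpha> * r))) \<le> ennreal \<gamma>)"

subsection \<open>Borel signed measures\<close>

text \<open>A signed measure takes at most one of the values \<open>\<infinity>\<close> and \<open>-\<infinity>\<close>.  The exclusion of the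
  other case, implicit in ordinary countable additivity, has to be stated here because addition
  on type \<open>ereal\<close> is total (with \<open>\<infinity> + -\<infinity> = \<infinity>\<close>).\<close>

definition signed_borel_measure :: "('a::topological_space set \<Rightarrow> ereal) \<Rightarrow> bool" where
  "signed_borel_measure \<mu> \<longleftrightarrow>
     \<mu> {} = 0 \<and>
     \<not> ((\<exists>A\<in>sets borel. \<mu> A = \<infinity>) \<and> (\<exists>A\<in>sets borel. \<mu> A = -\<infinity>)) \<and>
     (\<forall>A :: nat \<Rightarrow> 'a set. range A \<subseteq> sets borel \<longrightarrow> disjoint_family A \<longrightarrow>
        (\<lambda>n. \<mu> (A n)) sums \<mu> (\<Union>n. A n))"

definition jordan_decomposition ::
  "('a::topological_space set \<Rightarrow> ereal) \<Rightarrow> 'a measure \<Rightarrow> 'a measure \<Rightarrow> bool" where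
  "jordan_decomposition \<mu> P N \<longleftrightarrow>
     sets P = sets borel \<and> sets N = sets borel \<and>
     (\<exists>S\<in>sets borel. emeasure P (- S) = 0 \<and> emeasure N S = 0) \<and>
     (emeasure P UNIV < \<infinity> \<or> emeasure N UNIV < \<infinity>) \<and>
     (\<forall>A\<in>sets borel. \<mu> A = enn2ereal (emeasure P A) - enn2ereal (emeasure N A))"

text \<open>By the Hahn decomposition theorem the Jordan decomposition of a Borel signed measure exists
  and is unique, so the following definite descriptions denote \<open>\<mu>\<^sup>+\<close> and \<open>\<mu>\<^sup>-\<close>.\<close>

definition pos_variation :: "('a::topological_space set \<Rightarrow> ereal) \<Rightarrow> 'a measure" where
  "pos_variation \<mu> = (THE P. \<exists>N. jordan_decomposition \<mu> P N)"

definition neg_variation :: "('a::topological_space set \<Rightarrow> ereal) \<Rightarrow> 'a measure" where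
  "neg_variation \<mu> = (THE N. \<exists>P. jordan_decomposition \<mu> P N)"

definition total_variation :: "('a::topological_space set \<Rightarrow> ereal) \<Rightarrow> 'a set \<Rightarrow> ennreal" where
  "total_variation \<mu> A = emeasure (pos_variation \<mu>) A + emeasure (neg_variation \<mu>) A"

text \<open>Local finiteness is finiteness on bounded sets, as it is for \<open>asymptotically_bounded\<close>.\<close>

definition locally_finite_signed :: "('a::metric_space set \<Rightarrow> ereal) \<Rightarrow> bool" where
  "locally_finite_signed \<mu> \<longleftrightarrow>
     (\<forall>A\<in>sets borel. bounded A \<longrightarrow> total_variation \<mu> A < \<infinity>)"

text \<open>Borel regularity: every set has a Borel hull of the same (outer) measure, where a measure on
  the Borel sets is extended to all sets by taking the infimum over Borel supersets.  With this
  extension the property holds for every Borel measure.\<close>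

definition borel_regular_measure :: "'a::topological_space measure \<Rightarrow> bool" where
  "borel_regular_measure M \<longleftrightarrow>
     (\<forall>A. \<exists>B\<in>sets borel. A \<subseteq> B \<and> emeasure M B = outer_measure_of M A)"

definition borel_regular_signed :: "('a::topological_space set \<Rightarrow> ereal) \<Rightarrow> bool" where
  "borel_regular_signed \<mu> \<longleftrightarrow>
     borel_regular_measure (pos_variation \<mu>) \<and> borel_regular_measure (neg_variation \<mu>)"

subsection \<open>Premeasures and the packing construction\<close>

text \<open>A premeasure is modelled by a total function \<open>q\<close> on sets with \<open>q {} = 0\<close>; only its values at
  \<open>{}\<close> and at closed balls of positive radius are ever used.  A closed ball is a point set, which
  may have several centres and radii.\<close>

definition packing :: "'a::metric_space set \<Rightarrow> real \<Rightarrow> 'a set set \<Rightarrow> bool" where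
  "packing U \<delta> F \<longleftrightarrow>
     countable F \<and> disjoint F \<and>
     (\<forall>B\<in>F. \<exists>x r. 0 < r \<and> r < \<delta> \<and> B = cball x r) \<and> \<Union>F \<subseteq> U"

definition packing_premeasure ::
  "('a::metric_space set \<Rightarrow> ennreal) \<Rightarrow> real \<Rightarrow> 'a set \<Rightarrow> ennreal" where
  "packing_premeasure q \<delta> U = (SUP F\<in>{F. packing U \<delta> F}. \<Sum>\<^sub>\<infinity>B\<in>F. q B)"

definition packing_open :: "('a::metric_space set \<Rightarrow> ennreal) \<Rightarrow> 'a set \<Rightarrow> ennreal" where
  "packing_open q U = (INF \<delta>\<in>{0<..}. packing_premeasure q \<delta> U)"

definition packing_measure :: "('a::metric_space set \<Rightarrow> ennreal) \<Rightarrow> 'a set \<Rightarrow> ennreal" where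
  "packing_measure q A = (INF U\<in>{U. open U \<and> A \<subseteq> U}. packing_open q U)"

text \<open>\<open>setdist\<close> is \<open>0\<close> if one of its arguments is empty; additivity is trivial in that case.\<close>

definition metric_outer_measure :: "('a::metric_space set \<Rightarrow> ennreal) \<Rightarrow> bool" where
  "metric_outer_measure f \<longleftrightarrow>
     outer_measure_space UNIV f \<and>
     (\<forall>E F. setdist E F > 0 \<longrightarrow> f (E \<union> F) = f E + f F)"

end

theory Submission
  imports Defs
begin

text \<open>In a directionally limited space, closed balls satisfy a Besicovitch covering theorem, so a fine
  family of balls centred in a set can be packed so as to exhaust that set up to small measure.
  At \<open>\<mu>\<^sup>+\<close>-almost every point arbitrarily small balls satisfy
  \<open>\<mu>\<^sup>+ (B\<^sub>r) \<le> \<gamma>' * \<mu>\<^sup>+ (B\<^bsub>\<alpha>r\<^esub>)\<close> for any given \<open>\<gamma>' > \<gamma>\<close> (otherwise the density of \<open>\<mu>\<^sup>+\<close> with respect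
  to \<open>\<nu>\<close> would tend to \<open>0\<close> along a sequence of radii) and carry a negligible amount of \<open>\<mu>\<^sup>-\<close>.
  Packing such balls gives the lower bound \<open>\<mu>\<^sup>+ (U) / (\<gamma> C)\<close> for open \<open>U\<close>; the upper bound is immediate.
  Comparison with \<open>\<mu>\<^sup>+\<close> then makes the packing construction countably subadditive, because balls
  that meet the boundary of an open set have small \<open>\<mu>\<^sup>+\<close>-measure, and open sets are Caratheodory
  measurable.  The bounds preserve mutual singularity, hence the Jordan decomposition.\<close>

subsection \<open>A covering theorem in directionally limited spaces\<close>

text \<open>The packing supremum is superadditive on disjoint open sets by its very form, but a ball
  inside a union of open sets need not lie in any one of them, so subadditivity has to be imported
  from a genuine measure. For this the lower bound on open sets must be available before any
  property of the outer measures: it turns finiteness of packing sums into finiteness of the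
  variation, whose continuity from above then absorbs the balls in boundary layers. The multiplicity
  constant of the covering theorem must not appear in the final bounds. It enters only the rate at
  which repeated packing exhausts a set, and after enough rounds the remainder is as small as
  desired. Doubling at all small radii is known for \<nu> only. For the variations it is found at
  some arbitrarily small radii, which is all that a fine family of balls requires. The two signs are
  exchanged by swapping the variations together with the two halves of the Hahn
  decomposition.\<close>

lemma wf_kernel:
  assumes "wf R"
  obtains S where "\<And>x. x \<in> S \<longleftrightarrow> x \<in> A \<and> (\<forall>y\<in>S. (y, x) \<in> R \<longrightarrow> \<not> Q y x)"
proof -
  \<comment> \<open>Greedy selection: whether \<open>x\<close> is taken depends only on which
    predecessors were taken, so membership is a Boolean function defined by recursion along
    \<open>R\<close>.\<close>
  define f where "f = wfrec R (\<lambda>f x. x \<in> A \<and> (\<forall>y. (y, x) \<in> R \<longrightarrow> f y \<longrightarrow> \<not> Q y x))"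
  have f: "f x \<longleftrightarrow> x \<in> A \<and> (\<forall>y. (y, x) \<in> R \<longrightarrow> f y \<longrightarrow> \<not> Q y x)" for x
  proof -
    have "f x \<longleftrightarrow> x \<in> A \<and> (\<forall>y. (y, x) \<in> R \<longrightarrow> cut f R x y \<longrightarrow> \<not> Q y x)"
      unfolding f_def by (subst wfrec[OF assms]) (rule refl)
    also have "\<dots> \<longleftrightarrow> x \<in> A \<and> (\<forall>y. (y, x) \<in> R \<longrightarrow> f y \<longrightarrow> \<not> Q y x)"
      using cut_apply[of _ x R f] by metis
    finally show ?thesis .
  qed
  show thesis
  proof (rule that[of "Collect f"])
    show "x \<in> Collect f \<longleftrightarrow> x \<in> A \<and> (\<forall>y\<in>Collect f. (y, x) \<in> R \<longrightarrow> \<not> Q y x)" for x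
      using f[of x] by blast
  qed
qed

lemma wf_colouring:
  assumes "wf R"
    and fin: "\<And>x. x \<in> S \<Longrightarrow> finite {y\<in>S. (y, x) \<in> R \<and> Q y x}"
    and card: "\<And>x. x \<in> S \<Longrightarrow> card {y\<in>S. (y, x) \<in> R \<and> Q y x} \<le> M"
  obtains c :: "'a \<Rightarrow> nat" where "\<And>x. x \<in> S \<Longrightarrow> c x \<le> M"
    and "\<And>x y. x \<in> S \<Longrightarrow> y \<in> S \<Longrightarrow> (y, x) \<in> R \<Longrightarrow> Q y x \<Longrightarrow> c y \<noteq> c x"
proof -
  define E where "E x = {y\<in>S. (y, x) \<in> R \<and> Q y x}" for x
  define c where "c = wfrec R (\<lambda>c x. LEAST n::nat. n \<notin> c ` E x)"
  have c: "c x = (LEAST n. n \<notin> c ` E x)" for x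
  proof -
    have "cut c R x ` E x = c ` E x"
      by (rule image_cong) (auto simp: E_def cut_apply)
    then show ?thesis
      unfolding c_def by (subst wfrec[OF assms(1)]) simp
  qed
  have ex: "\<exists>n\<le>M. n \<notin> c ` E x" if "x \<in> S" for x
  proof (rule ccontr)
    assume "\<not> (\<exists>n\<le>M. n \<notin> c ` E x)"
    then have "{..M} \<subseteq> c ` E x" by auto
    then have "Suc M \<le> card (c ` E x)"
      using fin[OF that] card_mono[of "c ` E x" "{..M}"] by (auto simp: E_def)
    also have "\<dots> \<le> M"
      using card_image_le[of "E x" c] fin[OF that] card[OF that] by (auto simp: E_def)
    finally show False by simp
  qed
  show thesis
  proof
    fix x assume "x \<in> S"
    with ex obtain n where "n \<le> M" "n \<notin> c ` E x" by blast
    then show "c x \<le> M"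
      unfolding c[of x] by (meson Least_le le_trans)
  next
    fix x y assume x: "x \<in> S" and y: "y \<in> S" "(y, x) \<in> R" "Q y x"
    from ex[OF x] have "c x \<notin> c ` E x"
      unfolding c[of x] by (metis (mono_tags, lifting) LeastI)
    moreover have "c y \<in> c ` E x" using y by (auto simp: E_def)
    ultimately show "c y \<noteq> c x" by metis
  qed
qed

text \<open>Balls that meet \<open>cball a r\<close> are sorted by \<open>dist a b\<close> into annuli of width \<open>r / 6\<close> inside
  \<open>ball a (2 * r)\<close> and the far region outside it; the centres in each of these thirteen classes
  are directionally separated as seen from \<open>a\<close>.\<close>

lemma card_meeting_balls:
  fixes a :: "'a::metric_space"
  assumes dl: "directionally_limited_at \<xi> \<eta> \<zeta> (UNIV :: 'a set)" and \<eta>: "\<eta> \<le> 1/3" and r: "r > 0"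
    and I: "\<And>b. b \<in> I \<Longrightarrow> \<rho> b < dist a b \<and> dist a b \<le> \<rho> b + r \<and> r \<le> 7/6 * \<rho> b \<and> \<rho> b + r < \<xi>"
    and sep: "\<And>b c. b \<in> I \<Longrightarrow> c \<in> I \<Longrightarrow> b \<noteq> c \<Longrightarrow>
        \<rho> b < dist b c \<and> \<rho> c \<le> 7/6 * \<rho> b \<or> \<rho> c < dist b c \<and> \<rho> b \<le> 7/6 * \<rho> c"
  shows "finite I \<and> card I \<le> 13 * \<zeta>"
proof -
  define J where "J m = {b\<in>I. min 12 (nat \<lfloor>6 * dist a b / r\<rfloor>) = m}" for m
  have J: "finite (J m) \<and> card (J m) \<le> \<zeta>" for m
  proof (rule dl[unfolded directionally_limited_at_def, rule_format, of a])
    show "J m \<subseteq> UNIV \<inter> (ball a \<xi> - {a})"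
      using I r by (fastforce simp: J_def)
  next
    fix b c x
    assume b: "b \<in> J m" and c: "c \<in> J m" and bc: "b \<noteq> c \<and> dist a c \<le> dist a b"
      and x: "dist a x = dist a c \<and> dist a x + dist x b = dist a b"
    have bI: "b \<in> I" and cI: "c \<in> I" using b c by (auto simp: J_def)
    note Ib = I[OF bI] and Ic = I[OF cI] and s = sep[OF bI cI conjunct1[OF bc]]
    have c0: "dist a c > 0" using Ic r by linarith
    have tri: "dist b c \<le> dist x b + dist x c"
      by (metis dist_commute dist_triangle2)
    \<comment> \<open>Here \<open>x\<close> lies at distance \<open>dist a b - dist a c\<close> from
      \<open>b\<close>, so \<open>dist x c\<close> is at least \<open>dist b c\<close> minus that
      difference. The value 1/3 matches the bound \<open>\<eta> \<le> 1/3\<close>.\<close>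
    have "dist x c \<ge> dist a c / 3"
    proof (cases "m = 12")
      case True
      with c have "12 \<le> 6 * dist a c / r" by (auto simp: J_def) linarith
      then have far: "2 * r \<le> dist a c" using r by (simp add: field_simps)
      from s show ?thesis
      proof
        assume "\<rho> b < dist b c \<and> \<rho> c \<le> 7/6 * \<rho> b"
        then show ?thesis using tri x Ib far by linarith
      next
        \<comment> \<open>The tight case: \<open>dist a b \<le> 7/6 * \<rho> c + r\<close> and
          \<open>\<rho> c < dist a c\<close> give \<open>dist x c > 5/6 * dist a c - r\<close>, and
          \<open>r \<le> dist a c / 2\<close> leaves exactly one third. This explains both the ratio
          7/6 and the radius \<open>2 * r\<close> beyond which a centre counts as far.\<close>
        assume "\<rho> c < dist b c \<and> \<rho> b \<le> 7/6 * \<rho> c"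
        then show ?thesis using tri x Ib Ic far by linarith
      qed
    next
      case False
      have m: "real m \<le> 6 * dist a y / r" "6 * dist a y / r < real m + 1" "m < 12" if "y \<in> J m" for y
      proof -
        have f: "nat \<lfloor>6 * dist a y / r\<rfloor> = m" "m < 12" using that False by (auto simp: J_def min_def split: if_splits)
        moreover have "0 \<le> 6 * dist a y / r" using r by simp
        ultimately show "real m \<le> 6 * dist a y / r" "6 * dist a y / r < real m + 1" "m < 12" by linarith+
      qed
      have mc: "real m * r \<le> 6 * dist a c" and mb: "6 * dist a b < (real m + 1) * r"
        and c': "6 * dist a c < (real m + 1) * r" and m12: "m < 12"
        using m[OF b] m[OF c] r by (auto simp: field_simps)
      have "(real m + 1) * r \<le> 12 * r" using m12 r by (intro mult_right_mono) auto
      then have near: "dist a c < 2 * r" using c' by linarith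
      have "dist a b - dist a c < r / 6" using mc mb by (simp add: algebra_simps)
      \<comment> \<open>Within one annulus \<open>dist x b < r / 6\<close>, hence
        \<open>dist x c > (6/7 - 1/6) * r = 29/42 * r\<close>, just above the \<open>2/3 * r\<close>
        that suffices when \<open>dist a c < 2 * r\<close>.\<close>
      moreover have "6/7 * r < dist b c" using s Ib Ic by linarith
      ultimately show ?thesis using tri x near r by linarith
    qed
    moreover have "\<eta> * dist a c \<le> 1/3 * dist a c"
      using \<eta> by (intro mult_right_mono) auto
    ultimately have "\<eta> * dist a c \<le> dist x c" by linarith
    then show "\<eta> \<le> dist x c / dist a c"
      using c0 by (simp only: pos_le_divide_eq)
  qed simp
  have IJ: "I = (\<Union>m\<in>{..12}. J m)" by (auto simp: J_def)
  have "card I \<le> (\<Sum>m\<in>{..12}. card (J m))"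
    unfolding IJ by (rule card_UN_le) simp
  also have "\<dots> \<le> (\<Sum>m\<in>{..12::nat}. \<zeta>)" by (intro sum_mono) (use J in auto)
  finally have "card I \<le> 13 * \<zeta>" by simp
  moreover have "finite I" unfolding IJ using J by blast
  ultimately show ?thesis by simp
qed

text \<open>Balls are selected greedily along a well-order that lists larger radii first, up to the
  factor \<open>7/6\<close>.\<close>

lemma besicovitch_covering:
  fixes A :: "'a::metric_space set"
  assumes dl: "directionally_limited_at \<xi> \<eta> \<zeta> (UNIV :: 'a set)" and \<eta>: "\<eta> \<le> 1/3"
    and \<rho>: "\<And>x. x \<in> A \<Longrightarrow> 0 < \<rho> x \<and> \<rho> x < \<xi> / 2"
  obtains S and c :: "'a \<Rightarrow> nat" where "S \<subseteq> A" "A \<subseteq> (\<Union>x\<in>S. cball x (\<rho> x))"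
    and "\<And>x. x \<in> S \<Longrightarrow> c x \<le> 13 * \<zeta>"
    and "\<And>x y. x \<in> S \<Longrightarrow> y \<in> S \<Longrightarrow> x \<noteq> y \<Longrightarrow> c x = c y \<Longrightarrow> cball x (\<rho> x) \<inter> cball y (\<rho> y) = {}"
proof -
  \<comment> \<open>Listing by decreasing radius is not well-founded, since radii can increase
    forever without a largest one. Rounding on a logarithmic scale to natural numbers repairs this
    at the price of the factor 7/6; ties are broken by an arbitrary well-order.\<close>
  define lev where "lev x = nat \<lfloor>log (7/6) (\<xi> / \<rho> x)\<rfloor>" for x
  have lev: "\<rho> x \<le> 7/6 * \<rho> y" if "x \<in> A" "y \<in> A" "lev y \<le> lev x" for x y
  proof -
    have x: "0 < \<rho> x" "\<rho> x < \<xi>" and y: "0 < \<rho> y" "\<rho> y < \<xi>"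
      using \<rho>[OF that(1)] \<rho>[OF that(2)] by auto
    have "0 \<le> log (7/6) (\<xi> / \<rho> x)" "0 \<le> log (7/6) (\<xi> / \<rho> y)"
      using x y by (auto simp: field_simps)
    then have "log (7/6) (\<xi> / \<rho> y) \<le> log (7/6) (\<xi> / \<rho> x) + log (7/6) (7/6)"
      using that(3) unfolding lev_def by simp linarith
    also have "\<dots> = log (7/6) (\<xi> / \<rho> x * (7/6))"
      using x by (subst log_mult) auto
    finally have "\<xi> / \<rho> y \<le> \<xi> / \<rho> x * (7/6)"
      using x y by (subst (asm) log_le_cancel_iff) auto
    then have "\<xi> * \<rho> x \<le> \<xi> * (7/6 * \<rho> y)" using x y by (simp add: field_simps)
    then show ?thesis using x by (subst (asm) mult_le_cancel_left_pos) auto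
  qed
  obtain W :: "'a rel" where "well_order_on UNIV W" using well_order_on by blast
  then have W: "wf (W - Id)" "total W" by (auto simp: well_order_on_def linear_order_on_def)
  define R where "R = inv_image (less_than <*lex*> (W - Id)) (\<lambda>x. (lev x, x))"
  have wfR: "wf R" unfolding R_def using W by (intro wf_inv_image wf_lex_prod) auto
  have tot: "(x, y) \<in> R \<or> (y, x) \<in> R" if "x \<noteq> y" for x y
    using W(2) that unfolding R_def total_on_def by auto
  have R_rad: "\<rho> x \<le> 7/6 * \<rho> y" if "x \<in> A" "y \<in> A" "(y, x) \<in> R" for x y
    using that by (intro lev) (auto simp: R_def)
  have irr: "(x, x) \<notin> R" for x using wfR by auto
  obtain S where S: "\<And>x. x \<in> S \<longleftrightarrow> x \<in> A \<and> (\<forall>y\<in>S. (y, x) \<in> R \<longrightarrow> \<not> x \<in> cball y (\<rho> y))"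
    using wf_kernel[OF wfR, of A "\<lambda>y x. x \<in> cball y (\<rho> y)"] by blast
  have SA: "S \<subseteq> A" using S by blast
  have S_sep: "\<rho> y < dist y x" if "x \<in> S" "y \<in> S" "(y, x) \<in> R" for x y
    using S[of x] that by auto
  have bound: "finite {y\<in>S. (y, x) \<in> R \<and> cball y (\<rho> y) \<inter> cball x (\<rho> x) \<noteq> {}} \<and>
      card {y\<in>S. (y, x) \<in> R \<and> cball y (\<rho> y) \<inter> cball x (\<rho> x) \<noteq> {}} \<le> 13 * \<zeta>" if x: "x \<in> S" for x
  proof (rule card_meeting_balls[OF dl \<eta>, of "\<rho> x" _ \<rho> x])
    show "0 < \<rho> x" using x SA \<rho> by auto
  next
    fix b assume b: "b \<in> {y\<in>S. (y, x) \<in> R \<and> cball y (\<rho> y) \<inter> cball x (\<rho> x) \<noteq> {}}"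
    then obtain z where "dist b z \<le> \<rho> b" "dist x z \<le> \<rho> x" by auto
    then have "dist x b \<le> \<rho> b + \<rho> x"
      using dist_triangle[of x b z] by (simp add: dist_commute)
    \<comment> \<open>Radii below \<open>\<xi> / 2\<close> keep the centres of two meeting balls
      within \<open>\<xi>\<close> of each other, the range in which the directional limitation
      speaks.\<close>
    moreover have "\<rho> b < \<xi>/2" "\<rho> x < \<xi>/2" using b x SA \<rho> by auto
    ultimately show "\<rho> b < dist x b \<and> dist x b \<le> \<rho> b + \<rho> x \<and> \<rho> x \<le> 7/6 * \<rho> b \<and> \<rho> b + \<rho> x < \<xi>"
      using S_sep[of x b] R_rad[of x b] b x SA by (auto simp: dist_commute)
  next
    fix b c assume "b \<in> {y\<in>S. (y, x) \<in> R \<and> cball y (\<rho> y) \<inter> cball x (\<rho> x) \<noteq> {}}"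
      "c \<in> {y\<in>S. (y, x) \<in> R \<and> cball y (\<rho> y) \<inter> cball x (\<rho> x) \<noteq> {}}" "b \<noteq> c"
    then show "\<rho> b < dist b c \<and> \<rho> c \<le> 7/6 * \<rho> b \<or> \<rho> c < dist b c \<and> \<rho> b \<le> 7/6 * \<rho> c"
      using tot[of b c] S_sep[of b c] S_sep[of c b] R_rad[of b c] R_rad[of c b] SA
      by (auto simp: dist_commute)
  qed
  obtain c :: "'a \<Rightarrow> nat" where c: "\<And>x. x \<in> S \<Longrightarrow> c x \<le> 13 * \<zeta>"
    "\<And>x y. x \<in> S \<Longrightarrow> y \<in> S \<Longrightarrow> (y, x) \<in> R \<Longrightarrow> cball y (\<rho> y) \<inter> cball x (\<rho> x) \<noteq> {} \<Longrightarrow> c y \<noteq> c x"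
    using wf_colouring[OF wfR, of S "\<lambda>y x. cball y (\<rho> y) \<inter> cball x (\<rho> x) \<noteq> {}" "13 * \<zeta>"] bound
    by blast
  show thesis
  proof (rule that[OF SA _ c(1)])
    show "A \<subseteq> (\<Union>x\<in>S. cball x (\<rho> x))"
    proof
      fix x assume x: "x \<in> A"
      show "x \<in> (\<Union>x\<in>S. cball x (\<rho> x))"
      proof (cases "x \<in> S")
        case True
        then show ?thesis using \<rho>[OF x] by (auto intro!: bexI[of _ x])
      next
        case False
        then show ?thesis using S[of x] x by blast
      qed
    qed
    show "cball x (\<rho> x) \<inter> cball y (\<rho> y) = {}" if "x \<in> S" "y \<in> S" "x \<noteq> y" "c x = c y" for x y
      using tot[OF that(3)] c(2)[OF that(1,2)] c(2)[OF that(2,1)] that(4) by (metis Int_commute)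
  qed
qed

section \<open>Exhaustion up to small measure by finite disjoint families of balls\<close>

lemma countable_disjoint_balls:
  fixes I :: "'a::metric_space set"
  assumes sep: "separable_space (euclidean :: 'a topology)"
    and \<rho>: "\<And>x. x \<in> I \<Longrightarrow> 0 < \<rho> x"
    and dis: "\<And>x y. x \<in> I \<Longrightarrow> y \<in> I \<Longrightarrow> x \<noteq> y \<Longrightarrow> cball x (\<rho> x) \<inter> cball y (\<rho> y) = {}"
  shows "countable I"
proof -
  obtain D :: "'a set" where D: "countable D" "closure D = UNIV"
    using sep by (auto simp: separable_space_def)
  have "\<exists>d\<in>D. d \<in> cball x (\<rho> x)" if x: "x \<in> I" for x
  proof -
    have "x \<in> closure D" using D(2) by simp
    then obtain d where "d \<in> D" "dist d x < \<rho> x"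
      using \<rho>[OF x] unfolding closure_approachable by blast
    then show ?thesis by (auto simp: dist_commute intro!: bexI[of _ d])
  qed
  then obtain d where d: "\<And>x. x \<in> I \<Longrightarrow> d x \<in> D \<and> d x \<in> cball x (\<rho> x)" by metis
  have "inj_on d I"
  proof (rule inj_onI)
    fix x y assume xy: "x \<in> I" "y \<in> I" "d x = d y"
    then have "d x \<in> cball x (\<rho> x) \<inter> cball y (\<rho> y)" using d[of x] d[of y] by auto
    then show "x = y" using dis[OF xy(1,2)] by blast
  qed
  moreover have "d ` I \<subseteq> D" using d by auto
  ultimately show ?thesis
    by (meson D(1) countable_image_inj_on countable_subset)
qed

text \<open>The covering splits into \<open>13 * \<zeta> + 1\<close> disjoint families, and one of
  them carries at least that fraction of the measure of \<open>H\<close>. Separability makes this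
  family countable, and keeping only finitely many of its balls costs at most a further factor 2.
  Since \<open>A\<close> need not be measurable, \<open>H\<close> plays the part of its measurable
  hull.\<close>

lemma vitali_step:
  fixes A :: "'a::metric_space set"
  assumes sep: "separable_space (euclidean :: 'a topology)"
    and dl: "directionally_limited_at \<xi> \<eta> \<zeta> (UNIV :: 'a set)" and \<eta>: "\<eta> \<le> 1/3"
    and \<rho>: "\<And>x. x \<in> A \<Longrightarrow> 0 < \<rho> x \<and> \<rho> x < \<xi> / 2"
    and P: "sets P = sets borel" and H: "H \<in> sets borel" "emeasure P H < \<infinity>"
    and hull: "\<And>D. D \<in> sets borel \<Longrightarrow> A \<subseteq> D \<Longrightarrow> emeasure P H \<le> emeasure P (H \<inter> D)"
  obtains F where "finite F" "F \<subseteq> (\<lambda>x. cball x (\<rho> x)) ` A" "disjoint F"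
    "measure P (H - \<Union>F) \<le> (1 - 1 / (2 * (13 * real \<zeta> + 1))) * measure P H"
proof (cases "measure P H = 0")
  case True
  with that[of "{}"] show thesis by simp
next
  case False
  have HP: "H \<in> sets P" "emeasure P H \<noteq> \<infinity>" using P H by auto
  have meas: "X \<in> sets borel \<Longrightarrow> H \<inter> X \<in> fmeasurable P" for X
    using HP P by (intro fmeasurable_Int_fmeasurable fmeasurableI) (auto simp: top.not_eq_extremum)
  obtain S and c :: "'a \<Rightarrow> nat" where S: "S \<subseteq> A" "A \<subseteq> (\<Union>x\<in>S. cball x (\<rho> x))"
    "\<And>x. x \<in> S \<Longrightarrow> c x \<le> 13 * \<zeta>"
    "\<And>x y. x \<in> S \<Longrightarrow> y \<in> S \<Longrightarrow> x \<noteq> y \<Longrightarrow> c x = c y \<Longrightarrow> cball x (\<rho> x) \<inter> cball y (\<rho> y) = {}"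
    by (rule besicovitch_covering[OF dl \<eta> \<rho>]) blast+
  define T where "T i = {x\<in>S. c x = i}" for i
  have Tc: "countable (T i)" for i
    by (rule countable_disjoint_balls[OF sep, of _ \<rho>]) (use S \<rho> in \<open>auto simp: T_def subset_eq\<close>)
  define D where "D i = (\<Union>x\<in>T i. cball x (\<rho> x))" for i
  have D: "D i \<in> sets borel" for i
    unfolding D_def using Tc by (intro sets.countable_UN') auto
  have AD: "A \<subseteq> (\<Union>i\<in>{..13*\<zeta>}. D i)"
  proof
    fix x assume "x \<in> A"
    then obtain y where "y \<in> S" "x \<in> cball y (\<rho> y)" using S(2) by auto
    then show "x \<in> (\<Union>i\<in>{..13*\<zeta>}. D i)" using S(3) by (auto simp: D_def T_def)
  qed
  have "\<exists>i. measure P H \<le> (13 * real \<zeta> + 1) * measure P (H \<inter> D i)"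
  proof (rule ccontr)
    assume "\<not> ?thesis"
    then have less: "measure P (H \<inter> D i) < measure P H / (13 * real \<zeta> + 1)" for i
      by (simp add: field_simps not_le) 
    have "emeasure P H \<le> emeasure P (H \<inter> (\<Union>i\<in>{..13*\<zeta>}. D i))"
      using D by (intro hull AD) auto
    moreover have "(\<Union>i\<in>{..13*\<zeta>}. D i) \<in> sets borel" using D by auto
    ultimately have "measure P H \<le> measure P (H \<inter> (\<Union>i\<in>{..13*\<zeta>}. D i))"
      unfolding measure_def
      by (intro enn2real_mono) (auto simp: top.not_eq_extremum[symmetric] fmeasurableD2[OF meas])
    also have "H \<inter> (\<Union>i\<in>{..13*\<zeta>}. D i) = (\<Union>i\<in>{..13*\<zeta>}. H \<inter> D i)" by auto
    also have "measure P \<dots> \<le> (\<Sum>i\<in>{..13*\<zeta>}. measure P (H \<inter> D i))"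
      by (intro measure_UNION_le) (use meas D in \<open>auto simp: fmeasurable_def\<close>)
    also have "\<dots> < (\<Sum>i\<in>{..13*\<zeta>}. measure P H / (13 * real \<zeta> + 1))"
      by (intro sum_strict_mono less) auto
    also have "\<dots> = measure P H" by (simp add: add_ac)
    finally show False by simp
  qed
  then obtain i where i: "measure P H \<le> (13 * real \<zeta> + 1) * measure P (H \<inter> D i)" by blast
  have pos: "measure P (H \<inter> D i) > 0"
  proof (rule ccontr)
    assume "\<not> 0 < measure P (H \<inter> D i)"
    then have "measure P (H \<inter> D i) = 0" using measure_nonneg[of P "H \<inter> D i"] by linarith
    then show False using i False measure_nonneg[of P H] by simp
  qed
  then have "T i \<noteq> {}" by (auto simp: D_def)
  \<comment> \<open>The enumeration may repeat points; distinct centres are recovered below from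
    distinct balls.\<close>
  then obtain e :: "nat \<Rightarrow> 'a" where e: "range e = T i"
    using range_from_nat_into[OF _ Tc] by blast
  define G where "G n = (\<Union>x\<in>e ` {..<n}. cball x (\<rho> x))" for n
  have "(\<lambda>n. measure P (H \<inter> G n)) \<longlonglongrightarrow> measure P (\<Union>n. H \<inter> G n)"
  proof (rule Lim_measure_incseq)
    have "G n \<in> sets borel" for n unfolding G_def by (intro sets.finite_UN) auto
    then show "range (\<lambda>n. H \<inter> G n) \<subseteq> sets P" unfolding P using H(1) by auto
    show "incseq (\<lambda>n. H \<inter> G n)"
      unfolding incseq_def G_def by (intro allI impI Int_mono UN_mono image_mono) auto
    have "(\<Union>n. H \<inter> G n) \<subseteq> H" by auto
    then show "emeasure P (\<Union>n. H \<inter> G n) \<noteq> \<infinity>"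
      using neq_top_trans[OF _ emeasure_mono, of P H "\<Union>n. H \<inter> G n"] HP by auto
  qed
  moreover have "(\<Union>n. H \<inter> G n) = H \<inter> D i"
    by (auto simp: G_def D_def simp flip: e)
  ultimately have "(\<lambda>n. measure P (H \<inter> G n)) \<longlonglongrightarrow> measure P (H \<inter> D i)" by simp
  moreover have "measure P H / (2 * (13 * real \<zeta> + 1)) < measure P (H \<inter> D i)"
  proof -
    have "measure P H / (2 * (13 * real \<zeta> + 1))
        \<le> (13 * real \<zeta> + 1) * measure P (H \<inter> D i) / (2 * (13 * real \<zeta> + 1))"
      using i by (intro divide_right_mono) auto
    also have "\<dots> = measure P (H \<inter> D i) / 2" by (simp add: field_simps)
    also have "\<dots> < measure P (H \<inter> D i)" using pos by simp
    finally show ?thesis .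
  qed
  ultimately have "\<forall>\<^sub>F n in sequentially. measure P H / (2 * (13 * real \<zeta> + 1)) < measure P (H \<inter> G n)"
    by (rule order_tendstoD)
  then obtain n where n: "measure P H / (2 * (13 * real \<zeta> + 1)) < measure P (H \<inter> G n)"
    by (auto simp: eventually_sequentially)
  define F where "F = (\<lambda>x. cball x (\<rho> x)) ` e ` {..<n}"
  have FG: "\<Union>F = G n" by (auto simp: F_def G_def)
  have eT: "e ` {..<n} \<subseteq> T i" using e by auto
  show thesis
  proof (rule that)
    show "finite F" by (simp add: F_def)
    show "F \<subseteq> (\<lambda>x. cball x (\<rho> x)) ` A" using eT S(1) by (auto simp: F_def T_def)
    show "disjoint F"
      unfolding F_def disjoint_def
    proof (intro ballI impI)
      fix b c assume "b \<in> (\<lambda>x. cball x (\<rho> x)) ` e ` {..<n}" "c \<in> (\<lambda>x. cball x (\<rho> x)) ` e ` {..<n}" "b \<noteq> c"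
      then obtain k l where kl: "b = cball (e k) (\<rho> (e k))" "c = cball (e l) (\<rho> (e l))"
        by blast
      moreover have "e k \<noteq> e l" using kl \<open>b \<noteq> c\<close> by metis
      moreover have "e k \<in> T i" "e l \<in> T i" using e by blast+
      ultimately show "b \<inter> c = {}" using S(4)[of "e k" "e l"] by (simp add: T_def)
    qed
    have Gm: "G n \<in> sets borel" by (auto simp: G_def)
    have "measure P (H - H \<inter> G n) = measure P H - measure P (H \<inter> G n)"
      using HP Gm P by (intro measure_Diff) auto
    moreover have "H - H \<inter> G n = H - G n" by auto
    ultimately have "measure P (H - G n) = measure P H - measure P (H \<inter> G n)" by simp
    with n show "measure P (H - \<Union>F) \<le> (1 - 1 / (2 * (13 * real \<zeta> + 1))) * measure P H"
      unfolding FG by (simp add: algebra_simps)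
  qed
qed


lemma packing_union:
  assumes "packing U \<delta> F" "packing V \<delta> G" "U \<inter> V = {}" "U \<subseteq> W" "V \<subseteq> W"
  shows "packing W \<delta> (F \<union> G)"
proof -
  have UV: "\<Union>F \<subseteq> U" "\<Union>G \<subseteq> V" "disjoint F" "disjoint G"
    using assms(1,2) by (auto simp: packing_def)
  then have "disjoint (F \<union> G)" using assms(3) by (intro disjoint_union) blast+
  moreover have "\<Union>(F \<union> G) \<subseteq> W" using UV(1,2) assms(4,5) by blast
  moreover have "countable (F \<union> G)" using assms(1,2) by (simp add: packing_def)
  moreover have "\<forall>B\<in>F \<union> G. \<exists>x r. 0 < r \<and> r < \<delta> \<and> B = cball x r"
    using assms(1,2) by (simp add: packing_def ball_Un)
  ultimately show ?thesis by (simp add: packing_def)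
qed

lemma sum_packing_le_emeasure:
  fixes U :: "'a::metric_space set"
  assumes "sets P = sets borel" "packing U \<delta> F" "finite F" "\<Union>F \<subseteq> D" "D \<in> sets borel"
  shows "(\<Sum>B\<in>F. emeasure P B) \<le> emeasure P D"
proof -
  have B: "B \<in> sets P" if "B \<in> F" for B
    using that assms(1,2) by (auto simp: packing_def)
  then have "(\<Sum>B\<in>F. emeasure P B) = emeasure P (\<Union>B\<in>F. B)"
    using assms(2,3) by (intro sum_emeasure) (auto simp: packing_def disjoint_family_on_def disjoint_def)
  also have "\<dots> \<le> emeasure P D" using assms by (intro emeasure_mono) auto
  finally show ?thesis .
qed

text \<open>Each round applies the preceding lemma to the part of \<open>A\<close> outside the balls
  already chosen, so the rest of the hull decays like a power of \<open>\<theta>\<close>; the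
  constant \<open>\<zeta>\<close> affects only the number of rounds. Intersecting the hull with
  \<open>U\<close> makes its measure finite.\<close>

lemma vitali_packing:
  fixes A :: "'a::metric_space set"
  assumes sep: "separable_space (euclidean :: 'a topology)"
    and lim: "directionally_limited TYPE('a)"
    and P: "sets P = sets borel" and U: "open U" "emeasure P U < \<infinity>" "A \<subseteq> U" and \<delta>: "\<delta> > 0"
    and fine: "\<And>x \<epsilon>. x \<in> A \<Longrightarrow> \<epsilon> > 0 \<Longrightarrow> \<exists>r. 0 < r \<and> r < \<epsilon> \<and> Q (cball x r)"
    and e: "e > 0"
  obtains F where "finite F" "packing U \<delta> F" "\<And>B. B \<in> F \<Longrightarrow> Q B"
    "outer_measure_of P A \<le> (\<Sum>B\<in>F. emeasure P B) + ennreal e"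
proof -
  from lim obtain \<xi> \<eta> \<zeta> where \<xi>: "\<xi> > 0" and \<eta>: "\<eta> \<le> 1/3"
    and dl: "directionally_limited_at \<xi> \<eta> \<zeta> (UNIV :: 'a set)"
    unfolding directionally_limited_def by blast
  have spP: "space P = UNIV" using sets_eq_imp_space_eq[OF P] by simp
  obtain H0 where H0: "H0 \<in> sets P" "A \<subseteq> H0" "outer_measure_of P A = emeasure P H0"
    using outer_measure_of_attain[of A P] spP by auto
  define H where "H = H0 \<inter> U"
  have HP: "H \<in> sets borel" "H \<subseteq> U" "A \<subseteq> H" using H0 U P by (auto simp: H_def)
  have Hfin: "emeasure P H < \<infinity>"
    using le_less_trans[OF emeasure_mono U(2), of H] U HP P by auto
  have hull: "emeasure P H \<le> emeasure P D" if "D \<in> sets borel" "A \<subseteq> D" for D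
  proof -
    have "emeasure P H \<le> emeasure P H0" using H0 by (intro emeasure_mono) (auto simp: H_def)
    also have "\<dots> = outer_measure_of P A" using H0 by simp
    also have "\<dots> \<le> emeasure P D"
      using that P outer_measure_of_mono[of A D P] by (simp add: outer_measure_of_eq)
    finally show ?thesis .
  qed
  define \<theta> where "\<theta> = 1 - 1 / (2 * (13 * real \<zeta> + 1))"
  have \<theta>: "0 \<le> \<theta>" "\<theta> < 1" by (auto simp: \<theta>_def field_simps)
  have it: "\<exists>F. finite F \<and> packing U \<delta> F \<and> (\<forall>B\<in>F. Q B) \<and>
      measure P (H - \<Union>F) \<le> \<theta> ^ n * measure P H" for n
  proof (induction n)
    case 0
    show ?case by (rule exI[of _ "{}"]) (simp add: packing_def)
  next
    case (Suc n)
    then obtain F where F: "finite F" "packing U \<delta> F" "\<forall>B\<in>F. Q B"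
      "measure P (H - \<Union>F) \<le> \<theta> ^ n * measure P H" by blast
    \<comment> \<open>Because \<open>F\<close> is finite its union is closed, so every uncovered
      point has room for small balls that avoid all balls of \<open>F\<close>.\<close>
    have "closed (\<Union>F)" using F(1,2) by (intro closed_Union) (auto simp: packing_def)
    then have V: "open (U - \<Union>F)" "\<Union>F \<in> sets borel" using U by auto
    have "\<exists>r. 0 < r \<and> r < \<xi> / 2 \<and> r < \<delta> \<and> cball x r \<subseteq> U - \<Union>F \<and> Q (cball x r)" if "x \<in> A - \<Union>F" for x
    proof -
      from V(1) that U(3) obtain s where s: "s > 0" "cball x s \<subseteq> U - \<Union>F"
        by (metis DiffE DiffI open_contains_cball subsetD)
      obtain r where "0 < r" "r < Min {s, \<xi> / 2, \<delta>}" "Q (cball x r)"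
        using fine[of x "Min {s, \<xi> / 2, \<delta>}"] s \<xi> \<delta> \<open>x \<in> A - \<Union>F\<close> by auto
      then show ?thesis using s(2) subset_cball[of r s x] by (intro exI[of _ r]) auto
    qed
    then obtain \<rho> where \<rho>: "\<And>x. x \<in> A - \<Union>F \<Longrightarrow> 0 < \<rho> x \<and> \<rho> x < \<xi> / 2 \<and> \<rho> x < \<delta> \<and>
        cball x (\<rho> x) \<subseteq> U - \<Union>F \<and> Q (cball x (\<rho> x))"
      by metis
    obtain G where G: "finite G" "G \<subseteq> (\<lambda>x. cball x (\<rho> x)) ` (A - \<Union>F)" "disjoint G"
      "measure P (H - \<Union>F - \<Union>G) \<le> \<theta> * measure P (H - \<Union>F)"
      unfolding \<theta>_def
    proof (rule vitali_step[OF sep dl \<eta>, of "A - \<Union>F" \<rho> P "H - \<Union>F"])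
      show "H - \<Union>F \<in> sets borel" using HP V by auto
      show "emeasure P (H - \<Union>F) < \<infinity>"
        using le_less_trans[OF emeasure_mono Hfin, of "H - \<Union>F"] HP P by auto
      \<comment> \<open>The hull property survives the removal of the chosen balls: adding
        \<open>H \<inter> \<Union>F\<close> to \<open>(H - \<Union>F) \<inter> D\<close> gives a
        Borel set that covers all of \<open>A\<close>, and the common summand cancels because it is
        finite.\<close>
      fix D :: "'a set" assume D: "D \<in> sets borel" "A - \<Union>F \<subseteq> D"
      have "emeasure P (H - \<Union>F) + emeasure P (H \<inter> \<Union>F) = emeasure P H"
        using HP V P by (subst plus_emeasure) (auto intro!: arg_cong[where f="emeasure P"])
      also have "\<dots> \<le> emeasure P ((H - \<Union>F) \<inter> D \<union> (H \<inter> \<Union>F))"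
        using D HP V by (intro hull) auto
      also have "\<dots> \<le> emeasure P ((H - \<Union>F) \<inter> D) + emeasure P (H \<inter> \<Union>F)"
        using D HP V P by (intro emeasure_subadditive) auto
      finally have "emeasure P (H \<inter> \<Union>F) + emeasure P (H - \<Union>F)
          \<le> emeasure P (H \<inter> \<Union>F) + emeasure P ((H - \<Union>F) \<inter> D)" by (simp add: add.commute)
      moreover have "emeasure P (H \<inter> \<Union>F) \<noteq> \<infinity>"
        using le_less_trans[OF emeasure_mono Hfin, of "H \<inter> \<Union>F"] HP P by auto
      ultimately show "emeasure P (H - \<Union>F) \<le> emeasure P ((H - \<Union>F) \<inter> D)"
        by (simp add: ennreal_add_left_cancel_le)
    qed (use \<rho> P in auto)
    have "packing (U - \<Union>F) \<delta> G"
    proof -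
      have "(\<exists>x r. 0 < r \<and> r < \<delta> \<and> B = cball x r) \<and> B \<subseteq> U - \<Union>F" if "B \<in> G" for B
        using that G(2) \<rho> by blast
      then show ?thesis using G(1,3) unfolding packing_def by (blast intro: countable_finite)
    qed
    moreover have "packing (\<Union>F) \<delta> F" using F(2) by (auto simp: packing_def)
    ultimately have "packing U \<delta> (F \<union> G)"
      using F(2) by (intro packing_union[of "\<Union>F" _ _ "U - \<Union>F"]) (auto simp: packing_def)
    moreover have "\<forall>B\<in>F \<union> G. Q B" using F(3) G(2) \<rho> by auto
    moreover have "measure P (H - \<Union>(F \<union> G)) \<le> \<theta> ^ Suc n * measure P H"
    proof -
      have "H - \<Union>(F \<union> G) = H - \<Union>F - \<Union>G" by auto
      then have "measure P (H - \<Union>(F \<union> G)) \<le> \<theta> * measure P (H - \<Union>F)" using G(4) by simp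
      also have "\<dots> \<le> \<theta> * (\<theta> ^ n * measure P H)" using F(4) \<theta> by (intro mult_left_mono) auto
      finally show ?thesis by simp
    qed
    ultimately show ?case using F(1) G(1) by blast
  qed
  have "(\<lambda>n. \<theta> ^ n * measure P H) \<longlonglongrightarrow> 0 * measure P H"
    using \<theta> by (intro tendsto_mult LIMSEQ_power_zero tendsto_const) auto
  then have "\<forall>\<^sub>F n in sequentially. \<theta> ^ n * measure P H < e"
    using e by (intro order_tendstoD(2)) auto
  then obtain n where n: "\<theta> ^ n * measure P H < e" by (auto simp: eventually_sequentially)
  from it[of n] obtain F where F: "finite F" "packing U \<delta> F" "\<forall>B\<in>F. Q B"
    "measure P (H - \<Union>F) \<le> \<theta> ^ n * measure P H" by blast
  have Fb: "\<Union>F \<in> sets borel" using F(1,2) by (auto simp: packing_def intro!: borel_closed closed_Union)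
  have "outer_measure_of P A \<le> outer_measure_of P H" using HP by (intro outer_measure_of_mono)
  also have "\<dots> = emeasure P H" using HP P by (simp add: outer_measure_of_eq)
  also have "\<dots> = emeasure P (H \<inter> \<Union>F) + emeasure P (H - \<Union>F)"
    using HP Fb P by (subst plus_emeasure) (auto intro!: arg_cong[where f="emeasure P"])
  also have "\<dots> \<le> (\<Sum>B\<in>F. emeasure P B) + ennreal e"
  proof (rule add_mono)
    have "emeasure P (H \<inter> \<Union>F) \<le> emeasure P (\<Union>B\<in>F. B)"
      using HP Fb P by (intro emeasure_mono) auto
    also have "\<dots> \<le> (\<Sum>B\<in>F. emeasure P B)"
      using F P by (intro emeasure_subadditive_finite) (auto simp: packing_def)
    finally show "emeasure P (H \<inter> \<Union>F) \<le> (\<Sum>B\<in>F. emeasure P B)" .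
    have "emeasure P (H - \<Union>F) \<noteq> \<infinity>"
      using le_less_trans[OF emeasure_mono Hfin, of "H - \<Union>F"] HP P by auto
    then show "emeasure P (H - \<Union>F) \<le> ennreal e"
      using F(4) n by (simp add: emeasure_eq_ennreal_measure ennreal_leI)
  qed
  finally show thesis using that F by blast
qed

subsection \<open>Outer regularity of locally finite Borel measures\<close>

text \<open>A closed set is the intersection of its decreasing open metric neighbourhoods, and
  continuity from above applies because the measure is finite.\<close>

lemma closed_approx_by_open:
  fixes K :: "'a::metric_space set"
  assumes P: "sets P = sets borel" and fin: "emeasure P UNIV < \<infinity>" and K: "closed K" and e: "e > 0"
  obtains V where "open V" "K \<subseteq> V" "emeasure P (V - K) < ennreal e"
proof -
  define V where "V n = (\<Union>x\<in>K. ball x (1 / Suc n))" for n :: nat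
  have V: "open (V n)" "K \<subseteq> V n" for n by (auto simp: V_def intro!: open_UN)
  have empty: "(\<Inter>n. V n - K) = {}"
  proof -
    have "x \<in> K" if "\<forall>n. x \<in> V n" for x
    proof -
      have "x \<in> closure K"
        unfolding closure_approachable
      proof (intro allI impI)
        fix e :: real assume "e > 0"
        then obtain n where n: "1 / Suc n < e" using nat_approx_posE by blast
        from that obtain y where "y \<in> K" "dist y x < 1 / Suc n" by (auto simp: V_def)
        with n show "\<exists>y\<in>K. dist y x < e" by force
      qed
      then show ?thesis using K by simp
    qed
    then show ?thesis by auto
  qed
  have "(\<lambda>n. emeasure P (V n - K)) \<longlonglongrightarrow> emeasure P (\<Inter>n. V n - K)"
  proof (rule Lim_emeasure_decseq)
    show "range (\<lambda>n. V n - K) \<subseteq> sets P" using V K P by auto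
    have "V n \<subseteq> V m" if "m \<le> n" for m n
    proof -
      have "1 / real (Suc n) \<le> 1 / real (Suc m)" using that by (intro divide_left_mono) auto
      then show ?thesis unfolding V_def by (intro UN_mono order_refl subset_ball)
    qed
    then show "decseq (\<lambda>n. V n - K)" unfolding decseq_def by blast
    show "emeasure P (V i - K) \<noteq> \<infinity>" for i
      using le_less_trans[OF emeasure_space[of P "V i - K"]] fin sets_eq_imp_space_eq[OF P] by auto
  qed
  then have "(\<lambda>n. emeasure P (V n - K)) \<longlonglongrightarrow> 0" unfolding empty by simp
  then have "\<forall>\<^sub>F n in sequentially. emeasure P (V n - K) < ennreal e"
    using e by (intro order_tendstoD(2)) auto
  then obtain n where "emeasure P (V n - K) < ennreal e" by (auto simp: eventually_sequentially)
  then show thesis using that V by blast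
qed

text \<open>The sets that can be squeezed between closed and open ones form a sigma-algebra.
  Approximation from inside is carried along because complements exchange the two sides. A countable
  union of the closed sets need not be closed; it is cut off at a finite stage, for which half of
  \<open>e\<close> is reserved.\<close>

lemma finite_borel_approx:
  fixes A :: "'a::metric_space set"
  assumes P: "sets P = sets borel" and fin: "emeasure P UNIV < \<infinity>" and A: "A \<in> sets borel"
  shows "\<forall>e>0. \<exists>K V. closed K \<and> open V \<and> K \<subseteq> A \<and> A \<subseteq> V \<and> emeasure P (V - K) < ennreal e"
proof -
  have spP: "space P = UNIV" using sets_eq_imp_space_eq[OF P] by simp
  have fm: "emeasure P X < \<infinity>" for X
    using emeasure_space[of P X] fin unfolding spP by (rule le_less_trans)
  have "A \<in> sigma_sets UNIV {S :: 'a set. closed S}" using A by (simp add: borel_eq_closed sets_measure_of)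
  then show ?thesis
  proof (induction rule: sigma_sets.induct)
    case (Basic K)
    then have K: "closed K" by simp
    show ?case
    proof (intro allI impI)
      fix e :: real assume "e > 0"
      then obtain V where "open V" "K \<subseteq> V" "emeasure P (V - K) < ennreal e"
        using closed_approx_by_open[OF P fin K] by blast
      then show "\<exists>L V. closed L \<and> open V \<and> L \<subseteq> K \<and> K \<subseteq> V \<and> emeasure P (V - L) < ennreal e"
        using K by blast
    qed
  next
    case Empty
    show ?case by (intro allI impI exI[of _ "{}"]) auto
  next
    case (Compl A)
    show ?case
    proof (intro allI impI)
      fix e :: real assume "e > 0"
      from Compl.IH[rule_format, OF this] obtain K V
        where "closed K" "open V" "K \<subseteq> A" "A \<subseteq> V" "emeasure P (V - K) < ennreal e" by blast
      moreover have "- K - - V = V - K" by auto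
      ultimately show "\<exists>K V. closed K \<and> open V \<and> K \<subseteq> UNIV - A \<and> UNIV - A \<subseteq> V \<and> emeasure P (V - K) < ennreal e"
        by (intro exI[of _ "- V"] exI[of _ "- K"]) auto
    qed
  next
    case (Union A)
    show ?case
    proof (intro allI impI)
      fix e :: real assume e: "e > 0"
      have "\<exists>K V. closed K \<and> open V \<and> K \<subseteq> A i \<and> A i \<subseteq> V \<and> emeasure P (V - K) < ennreal (e / 2 * (1/2) ^ Suc i)" for i
        using Union.IH[of i] e by simp
      then obtain K V where KV: "\<And>i. closed (K i)" "\<And>i. open (V i)" "\<And>i. K i \<subseteq> A i" "\<And>i. A i \<subseteq> V i"
        "\<And>i. emeasure P (V i - K i) < ennreal (e / 2 * (1/2) ^ Suc i)" by metis
      define W where "W = (\<Union>i. V i)"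
      define L where "L n = (\<Union>i<n. K i)" for n :: nat
      have L: "closed (L n)" for n using KV by (auto simp: L_def)
      have W: "open W" using KV by (auto simp: W_def)
      have empty: "(\<Inter>n. (\<Union>i. K i) - L n) = {}" by (auto simp: L_def)
      have "(\<lambda>n. emeasure P ((\<Union>i. K i) - L n)) \<longlonglongrightarrow> emeasure P (\<Inter>n. (\<Union>i. K i) - L n)"
      proof (rule Lim_emeasure_decseq)
        show "range (\<lambda>n. (\<Union>i. K i) - L n) \<subseteq> sets P" using KV(1) L P by auto
        show "decseq (\<lambda>n. (\<Union>i. K i) - L n)" by (auto simp: decseq_def L_def)
        show "emeasure P ((\<Union>i. K i) - L i) \<noteq> \<infinity>" for i using fm[of "(\<Union>i. K i) - L i"] by auto
      qed
      then have "(\<lambda>n. emeasure P ((\<Union>i. K i) - L n)) \<longlonglongrightarrow> 0" unfolding empty by simp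
      then have "\<forall>\<^sub>F n in sequentially. emeasure P ((\<Union>i. K i) - L n) < ennreal (e / 2)"
        using e by (intro order_tendstoD(2)) auto
      then obtain n where n: "emeasure P ((\<Union>i. K i) - L n) < ennreal (e / 2)"
        by (auto simp: eventually_sequentially)
      have "emeasure P (W - L n) \<le> emeasure P ((\<Union>i. V i - K i) \<union> ((\<Union>i. K i) - L n))"
        using KV L P by (intro emeasure_mono) (auto simp: W_def)
      also have "\<dots> \<le> emeasure P (\<Union>i. V i - K i) + emeasure P ((\<Union>i. K i) - L n)"
        using KV L P by (intro emeasure_subadditive) auto
      also have "emeasure P (\<Union>i. V i - K i) \<le> (\<Sum>i. emeasure P (V i - K i))"
        using KV P by (intro emeasure_subadditive_countably) auto
      also have "\<dots> \<le> (\<Sum>i. ennreal (e / 2 * (1/2) ^ Suc i))"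
        using KV(5) by (intro suminf_le) (auto simp: less_imp_le)
      also have "\<dots> = ennreal (e / 2)"
      proof (rule suminf_ennreal_eq)
        show "(\<lambda>i. e / 2 * (1/2) ^ Suc i) sums (e / 2)"
          using sums_mult[OF power_half_series, of "e/2"] by simp
      qed (use e in auto)
      also have "ennreal (e / 2) + emeasure P ((\<Union>i. K i) - L n) < ennreal (e / 2) + ennreal (e / 2)"
        using n by (simp add: ennreal_add_left_cancel_less)
      also have "\<dots> = ennreal e" using e by (simp flip: ennreal_plus)
      finally have "emeasure P (W - L n) < ennreal e" by (simp add: add_right_mono)
      moreover have "L n \<subseteq> (\<Union>i. A i)" "(\<Union>i. A i) \<subseteq> W" using KV(3,4) unfolding L_def W_def by blast+
      ultimately show "\<exists>K V. closed K \<and> open V \<and> K \<subseteq> (\<Union>i. A i) \<and> (\<Union>i. A i) \<subseteq> V \<and> emeasure P (V - K) < ennreal e"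
        using L[of n] W by (intro exI[of _ "L n"] exI[of _ W]) simp
    qed
  qed
qed

text \<open>On each open ball \<open>B n\<close> the measure is finite, and an open set cut down to
  \<open>B n\<close> stays open; the local excesses form a geometric series with sum
  \<open>e\<close>.\<close>

lemma locally_finite_borel_outer_regular:
  fixes A :: "'a::metric_space set"
  assumes P: "sets P = sets borel" and fin: "\<And>A. A \<in> sets borel \<Longrightarrow> bounded A \<Longrightarrow> emeasure P A < \<infinity>"
    and A: "A \<in> sets borel" and e: "e > 0"
  obtains V where "open V" "A \<subseteq> V" "emeasure P V \<le> emeasure P A + ennreal e"
proof -
  have spP: "space P = UNIV" using sets_eq_imp_space_eq[OF P] by simp
  fix x0 :: 'a
  define B where "B n = ball x0 (real (Suc n))" for n
  have "\<exists>V. open V \<and> A \<inter> B n \<subseteq> V \<and> V \<subseteq> B n \<and> emeasure P (V - A \<inter> B n) \<le> ennreal (e * (1/2) ^ Suc n)" for n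
  proof -
    define M where "M = density P (indicator (B n))"
    have Bn: "B n \<in> sets P" using P by (simp add: B_def)
    have M: "emeasure M X = emeasure P (B n \<inter> X)" if "X \<in> sets borel" for X
      unfolding M_def using that Bn P by (subst emeasure_density) (auto simp: nn_integral_indicator simp flip: indicator_inter_arith)
    have "emeasure M UNIV < \<infinity>" using M[of UNIV] fin[of "B n"] by (simp add: B_def)
    then obtain K V where KV: "closed K" "open V" "K \<subseteq> A" "A \<subseteq> V"
      "emeasure M (V - K) < ennreal (e * (1/2) ^ Suc n)"
      using finite_borel_approx[OF _ _ A, rule_format, of M "e * (1/2) ^ Suc n"] P e
      by (auto simp: M_def)
    have "emeasure P (V \<inter> B n - A \<inter> B n) \<le> emeasure P (B n \<inter> (V - K))"
      using KV Bn P by (intro emeasure_mono) auto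
    also have "\<dots> = emeasure M (V - K)" using KV by (intro M[symmetric]) auto
    finally have "emeasure P (V \<inter> B n - A \<inter> B n) \<le> ennreal (e * (1/2) ^ Suc n)" using KV by simp
    then show ?thesis
      using KV by (intro exI[of _ "V \<inter> B n"]) (auto simp: B_def)
  qed
  then obtain V where V: "\<And>n. open (V n)" "\<And>n. A \<inter> B n \<subseteq> V n"
    "\<And>n. emeasure P (V n - A \<inter> B n) \<le> ennreal (e * (1/2) ^ Suc n)" by metis
  have cov: "(\<Union>n. B n) = UNIV"
  proof -
    have "\<exists>n. x \<in> B n" for x
      using reals_Archimedean2[of "dist x0 x"] by (auto simp: B_def) (metis add.commute add_strict_increasing2 less_imp_le zero_less_one)
    then show ?thesis by auto
  qed
  show thesis
  proof
    show "open (\<Union>n. V n)" using V by auto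
    have "A = (\<Union>n. A \<inter> B n)" using cov by blast
    also have "\<dots> \<subseteq> (\<Union>n. V n)" using V(2) by (intro UN_mono) auto
    finally show "A \<subseteq> (\<Union>n. V n)" .
    have "emeasure P (\<Union>n. V n) \<le> emeasure P (A \<union> (\<Union>n. V n - A \<inter> B n))"
      using V A P by (intro emeasure_mono) (auto simp: B_def)
    also have "\<dots> \<le> emeasure P A + emeasure P (\<Union>n. V n - A \<inter> B n)"
      using V A P by (intro emeasure_subadditive) (auto simp: B_def)
    also have "emeasure P (\<Union>n. V n - A \<inter> B n) \<le> (\<Sum>n. emeasure P (V n - A \<inter> B n))"
      using V A P by (intro emeasure_subadditive_countably) (auto simp: B_def)
    also have "\<dots> \<le> (\<Sum>n. ennreal (e * (1/2) ^ Suc n))" using V by (intro suminf_le) auto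
    also have "\<dots> = ennreal e"
    proof (rule suminf_ennreal_eq)
      show "(\<lambda>i. e * (1/2) ^ Suc i) sums e"
        using sums_mult[OF power_half_series, of e] by simp
    qed (use e in auto)
    finally show "emeasure P (\<Union>n. V n) \<le> emeasure P A + ennreal e" by (simp add: add_left_mono)
  qed
qed

subsection \<open>Hahn and Jordan decomposition\<close>

lemma enn2ereal_eq_0: "enn2ereal x = 0 \<longleftrightarrow> x = 0"
  by (metis enn2ereal_inject zero_ennreal.rep_eq)

lemma signed_borel_measure_sums:
  assumes "signed_borel_measure \<mu>" "\<And>n. A n \<in> sets borel" "disjoint_family A"
  shows "(\<lambda>n. \<mu> (A n)) sums \<mu> (\<Union>n. A n)"
  using assms unfolding signed_borel_measure_def by blast

lemma signed_borel_measure_Un: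
  assumes \<mu>: "signed_borel_measure \<mu>" and "A \<in> sets borel" "B \<in> sets borel" "A \<inter> B = {}"
  shows "\<mu> (A \<union> B) = \<mu> A + \<mu> B"
proof -
  have 0: "\<mu> {} = 0" using \<mu> by (simp add: signed_borel_measure_def)
  have "(\<lambda>n. \<mu> (binaryset A B n)) sums \<mu> (\<Union>n. binaryset A B n)"
    using assms by (intro signed_borel_measure_sums)
      (auto simp: binaryset_def disjoint_family_on_def)
  moreover have "(\<lambda>n. \<mu> (binaryset A B n)) sums (\<Sum>n\<in>{0, Suc 0}. \<mu> (binaryset A B n))"
    using 0 by (intro sums_finite) (auto simp: binaryset_def)
  ultimately have "\<mu> (\<Union>n. binaryset A B n) = (\<Sum>n\<in>{0, Suc 0}. \<mu> (binaryset A B n))"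
    by (rule sums_unique2)
  then show ?thesis by (simp add: UN_binaryset_eq binaryset_def)
qed

lemma signed_borel_measure_split:
  assumes \<mu>: "signed_borel_measure \<mu>" and "A \<in> sets borel" "E \<in> sets borel" "E \<subseteq> A"
  shows "\<mu> A = \<mu> E + \<mu> (A - E)"
  using signed_borel_measure_Un[OF \<mu>, of E "A - E"] assms by (simp add: Un_absorb1)

lemma signed_borel_measure_uminus:
  assumes \<mu>: "signed_borel_measure \<mu>"
  shows "signed_borel_measure (\<lambda>A. - \<mu> A)"
  unfolding signed_borel_measure_def
proof (intro conjI allI impI)
  show "- \<mu> {} = 0" using \<mu> by (simp add: signed_borel_measure_def)
  show "\<not> ((\<exists>A\<in>sets borel. - \<mu> A = \<infinity>) \<and> (\<exists>A\<in>sets borel. - \<mu> A = - \<infinity>))"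
    using \<mu> by (auto simp: signed_borel_measure_def ereal_uminus_eq_reorder)
  fix A :: "nat \<Rightarrow> 'a set" assume A: "range A \<subseteq> sets borel" "disjoint_family A"
  have "(\<forall>i. \<mu> (A i) \<noteq> \<infinity>) \<or> (\<forall>i. \<mu> (A i) \<noteq> -\<infinity>)"
    using \<mu> A(1) unfolding signed_borel_measure_def by blast
  \<comment> \<open>On \<open>ereal\<close> negation distributes over a sum only if opposite
    infinities do not meet. The inductions therefore also record which infinity the partial sums
    avoid.\<close>
  then have "(\<Sum>i<n. - \<mu> (A i)) = - (\<Sum>i<n. \<mu> (A i))" for n
  proof
    assume f: "\<forall>i. \<mu> (A i) \<noteq> \<infinity>"
    have "(\<Sum>i<n. - \<mu> (A i)) = - (\<Sum>i<n. \<mu> (A i)) \<and> (\<Sum>i<n. \<mu> (A i)) \<noteq> \<infinity>"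
    proof (induction n)
      case (Suc n)
      then show ?case using f[rule_format, of n]
        by (cases "\<mu> (A n)" "\<Sum>i<n. \<mu> (A i)" rule: ereal2_cases) auto
    qed simp
    then show ?thesis ..
  next
    assume f: "\<forall>i. \<mu> (A i) \<noteq> -\<infinity>"
    have "(\<Sum>i<n. - \<mu> (A i)) = - (\<Sum>i<n. \<mu> (A i)) \<and> (\<Sum>i<n. \<mu> (A i)) \<noteq> -\<infinity>"
    proof (induction n)
      case (Suc n)
      then show ?case using f[rule_format, of n]
        by (cases "\<mu> (A n)" "\<Sum>i<n. \<mu> (A i)" rule: ereal2_cases) auto
    qed simp
    then show ?thesis ..
  qed
  then show "(\<lambda>n. - \<mu> (A n)) sums - \<mu> (\<Union>n. A n)"
    using signed_borel_measure_sums[OF \<mu>, of A] A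
    unfolding sums_def by (auto simp flip: ereal_Lim_uminus)
qed

text \<open>A negative set in the sense of Hahn. Positive sets are expressed as nonpositive sets of
  the negated measure, so that one notion serves both signs.\<close>

definition nonpositive_set :: "('a::topological_space set \<Rightarrow> ereal) \<Rightarrow> 'a set \<Rightarrow> bool" where
  "nonpositive_set \<mu> B \<longleftrightarrow> B \<in> sets borel \<and> (\<forall>E\<in>sets borel. E \<subseteq> B \<longrightarrow> \<mu> E \<le> 0)"

text \<open>Remove from \<open>A\<close>, again and again, a subset whose measure is at least half of the largest
  possible one (or at least \<open>1\<close>).  These measures are summable, so in the limit no subset of
  positive measure is left.\<close>

lemma nonpositive_subset_exists:
  fixes \<mu> :: "'a::topological_space set \<Rightarrow> ereal"
  assumes \<mu>: "signed_borel_measure \<mu>" and noMInf: "\<And>A. A \<in> sets borel \<Longrightarrow> \<mu> A \<noteq> -\<infinity>"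
    and A: "A \<in> sets borel" "\<mu> A \<noteq> \<infinity>"
  obtains B where "nonpositive_set \<mu> B" "B \<subseteq> A" "\<mu> B \<le> \<mu> A"
proof -
  define m where "m E = real_of_ereal (\<mu> E)" for E
  \<comment> \<open>If a subset had measure \<infinity>, so would \<open>A\<close>, because its
    complement in \<open>A\<close> cannot compensate with -\<infinity>. The argument can thus be run
    with real numbers.\<close>
  have m: "\<mu> E = ereal (m E)" if "E \<in> sets borel" "E \<subseteq> A" for E
  proof -
    have "A - E \<in> sets borel" using A that by auto
    then have "\<mu> E \<noteq> \<infinity>"
      using signed_borel_measure_split[OF \<mu> A(1) that] A(2) noMInf[of "A - E"] by auto
    then show ?thesis using noMInf[OF that(1)] unfolding m_def by (cases "\<mu> E") auto
  qed
  have "\<exists>E. E \<in> sets borel \<and> E \<subseteq> X \<and> 0 \<le> m E \<and> (1 \<le> m E \<or> (\<forall>F\<in>sets borel. F \<subseteq> X \<longrightarrow> m F \<le> 2 * m E))" for X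
  proof (cases "\<exists>E\<in>sets borel. E \<subseteq> X \<and> 1 \<le> m E")
    case True
    then show ?thesis by force
  next
    case False
    define T where "T = m ` {E \<in> sets borel. E \<subseteq> X}"
    have bdd: "bdd_above T" using False by (intro bdd_aboveI[of _ 1]) (auto simp: T_def)
    have m0: "m {} = 0" using \<mu> by (simp add: signed_borel_measure_def m_def)
    then have "0 \<in> T" by (auto simp: T_def intro!: image_eqI[of _ _ "{}"])
    then have "0 \<le> Sup T" using bdd by (rule cSup_upper)
    show ?thesis
    proof (cases "Sup T = 0")
      case True
      have "m F \<le> 0" if "F \<in> sets borel" "F \<subseteq> X" for F
        using cSup_upper[OF _ bdd, of "m F"] that True by (auto simp: T_def)
      then show ?thesis using m0 by (intro exI[of _ "{}"]) auto
    next
      case False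
      then have "Sup T / 2 < Sup T" using \<open>0 \<le> Sup T\<close> by simp
      then obtain t where "t \<in> T" "Sup T / 2 < t"
        using less_cSupE[of "Sup T / 2" T] \<open>0 \<in> T\<close> by blast
      then obtain E where E: "E \<in> sets borel" "E \<subseteq> X" "Sup T / 2 < m E" by (auto simp: T_def)
      have "m F \<le> 2 * m E" if "F \<in> sets borel" "F \<subseteq> X" for F
        using cSup_upper[OF _ bdd, of "m F"] that E(3) by (auto simp: T_def)
      then show ?thesis using E \<open>0 \<le> Sup T\<close> by (intro exI[of _ E]) auto
    qed
  qed
  then obtain g where g: "\<And>X. g X \<in> sets borel" "\<And>X. g X \<subseteq> X" "\<And>X. 0 \<le> m (g X)"
    "\<And>X. 1 \<le> m (g X) \<or> (\<forall>F\<in>sets borel. F \<subseteq> X \<longrightarrow> m F \<le> 2 * m (g X))" by metis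
  define X where "X = rec_nat A (\<lambda>_ Y. Y - g Y)"
  have X: "X 0 = A" "\<And>n. X (Suc n) = X n - g (X n)" by (simp_all add: X_def)
  define E where "E n = g (X n)" for n
  have XA: "X n \<subseteq> A" for n by (induction n) (auto simp: X)
  have XE: "X n = A - (\<Union>k<n. E k)" for n
    by (induction n) (auto simp: X E_def less_Suc_eq)
  have Em: "E n \<in> sets borel" "E n \<subseteq> A" "0 \<le> m (E n)" for n
    using g(1,3) subset_trans[OF g(2) XA] by (auto simp: E_def)
  have "E i \<inter> E j = {}" if "i < j" for i j
  proof -
    have "E j \<subseteq> A - (\<Union>k<j. E k)" using g(2)[of "X j"] unfolding E_def[of j] XE[symmetric] .
    then show ?thesis using that by blast
  qed
  then have dis: "disjoint_family E"
    unfolding disjoint_family_on_def by (metis Int_commute linorder_neqE_nat)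
  define W where "W = (\<Union>n. E n)"
  have W: "W \<in> sets borel" "W \<subseteq> A" using Em by (auto simp: W_def)
  have "(\<lambda>n. \<mu> (E n)) sums \<mu> W"
    unfolding W_def by (intro signed_borel_measure_sums[OF \<mu>] Em dis)
  then have sums: "(\<lambda>n. m (E n)) sums m W"
    using m[OF Em(1,2)] m[OF W] by (simp add: sums_ereal)
  \<comment> \<open>As \<open>m W\<close> is a real number, the series of removed measures
    converges. Its terms therefore tend to 0, and subsets of positive measure cannot
    persist.\<close>
  then have lim: "(\<lambda>n. m (E n)) \<longlonglongrightarrow> 0"
    using summable_LIMSEQ_zero sums_summable by blast
  have W0: "0 \<le> m W" using sums Em(3) sums_le[of "\<lambda>_. 0" "\<lambda>n. m (E n)" 0] by (auto simp: sums_zero)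
  show thesis
  proof
    show AW: "A - W \<subseteq> A" by auto
    have "\<mu> A = \<mu> W + \<mu> (A - W)" using W A by (intro signed_borel_measure_split[OF \<mu>])
    then show "\<mu> (A - W) \<le> \<mu> A" using m[OF W] m[of "A - W"] m[of A] W A W0 by auto
    show "nonpositive_set \<mu> (A - W)"
      unfolding nonpositive_set_def
    proof (intro conjI ballI impI)
      show "A - W \<in> sets borel" using A W by auto
      fix F assume F: "F \<in> sets borel" "F \<subseteq> A - W"
      have "\<not> 0 < m F"
      proof
        assume "0 < m F"
        then have "\<forall>\<^sub>F n in sequentially. m (E n) < min 1 (m F / 2)"
          by (intro order_tendstoD(2)[OF lim]) auto
        then obtain n where n: "m (E n) < min 1 (m F / 2)" by (auto simp: eventually_sequentially)
        moreover have "F \<subseteq> X n" using F(2) by (auto simp: XE W_def)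
        ultimately show False using g(4)[of "X n"] F(1) by (auto simp: E_def)
      qed
      moreover have "F \<subseteq> A" using F(2) by blast
      ultimately show "\<mu> F \<le> 0" using m[of F] F(1) by auto
    qed
  qed
qed

lemma nonpositive_set_UN:
  assumes \<mu>: "signed_borel_measure \<mu>" and B: "\<And>n::nat. nonpositive_set \<mu> (B n)"
  shows "nonpositive_set \<mu> (\<Union>n. B n)"
  unfolding nonpositive_set_def
proof (intro conjI ballI impI)
  have Bb: "B n \<in> sets borel" for n using B by (simp add: nonpositive_set_def)
  then show "(\<Union>n. B n) \<in> sets borel" by auto
  fix E assume E: "E \<in> sets borel" "E \<subseteq> (\<Union>n. B n)"
  have D: "disjointed B n \<in> sets borel" for n
    unfolding disjointed_def using Bb by auto
  have "(\<lambda>n. \<mu> (E \<inter> disjointed B n)) sums \<mu> (\<Union>n. E \<inter> disjointed B n)"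
  proof (rule signed_borel_measure_sums[OF \<mu>])
    show "disjoint_family (\<lambda>n. E \<inter> disjointed B n)"
      using disjoint_family_disjointed[of B] unfolding disjoint_family_on_def by blast
  qed (use E D in auto)
  moreover have "(\<Union>n. E \<inter> disjointed B n) = E"
    using E(2) UN_disjointed_eq[of B] by auto
  moreover have "\<mu> (E \<inter> disjointed B n) \<le> 0" for n
  proof -
    have "E \<inter> disjointed B n \<in> sets borel" using E(1) D by auto
    moreover have "E \<inter> disjointed B n \<subseteq> B n" using disjointed_subset[of B n] by blast
    ultimately show ?thesis using B[of n] unfolding nonpositive_set_def by blast
  qed
  ultimately show "\<mu> E \<le> 0"
    using sums_le[of "\<lambda>n. \<mu> (E \<inter> disjointed B n)" "\<lambda>_. 0" "\<mu> E" 0] sums_zero by simp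
qed

text \<open>The union \<open>U\<close> of a minimizing sequence of nonpositive sets attains the
  infimum of \<open>\<mu>\<close> over all of them, which is finite. A set of negative measure
  outside \<open>U\<close> would contain a nonpositive set of negative measure, and joining that to
  \<open>U\<close> would go below the infimum.\<close>

lemma hahn_decomposition_noMInf:
  fixes \<mu> :: "'a::topological_space set \<Rightarrow> ereal"
  assumes \<mu>: "signed_borel_measure \<mu>" and noMInf: "\<And>A. A \<in> sets borel \<Longrightarrow> \<mu> A \<noteq> -\<infinity>"
  obtains B where "nonpositive_set \<mu> B" "nonpositive_set (\<lambda>A. - \<mu> A) (- B)"
proof -
  have 0: "\<mu> {} = 0" using \<mu> by (simp add: signed_borel_measure_def)
  define T where "T = \<mu> ` {B. nonpositive_set \<mu> B}"
  have "\<mu> {} \<in> T" using 0 by (auto simp: T_def nonpositive_set_def)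
  then obtain f :: "nat \<Rightarrow> ereal" where f: "range f \<subseteq> T" "Inf T = (INF i. f i)"
    using Inf_countable_INF[of T] by auto
  then have "\<forall>n. \<exists>B. nonpositive_set \<mu> B \<and> f n = \<mu> B" by (auto simp: T_def)
  then obtain B where B: "\<And>n. nonpositive_set \<mu> (B n)" "\<And>n. f n = \<mu> (B n)" by metis
  define U where "U = (\<Union>n. B n)"
  have U: "nonpositive_set \<mu> U" unfolding U_def using B by (intro nonpositive_set_UN[OF \<mu>])
  then have Ub: "U \<in> sets borel" by (simp add: nonpositive_set_def)
  have "\<mu> U \<le> \<mu> (B n)" for n
  proof -
    have Bn: "B n \<in> sets borel" "B n \<subseteq> U" using B by (auto simp: nonpositive_set_def U_def)
    have "\<mu> U = \<mu> (B n) + \<mu> (U - B n)" using Bn Ub by (intro signed_borel_measure_split[OF \<mu>])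
    also have "\<dots> \<le> \<mu> (B n) + 0"
      using U Bn Ub by (intro add_left_mono) (auto simp: nonpositive_set_def)
    finally show ?thesis by simp
  qed
  then have "\<mu> U \<le> Inf T" unfolding f(2) B(2) by (intro INF_greatest)
  then have least: "\<mu> U \<le> \<mu> C" if "nonpositive_set \<mu> C" for C
    using order_trans[OF \<open>\<mu> U \<le> Inf T\<close> Inf_lower[of "\<mu> C" T]] that by (auto simp: T_def)
  show thesis
  proof (rule that[OF U])
    show "nonpositive_set (\<lambda>A. - \<mu> A) (- U)"
      unfolding nonpositive_set_def
    proof (intro conjI ballI impI)
      show "- U \<in> sets borel" using Ub by auto
      fix A assume A: "A \<in> sets borel" "A \<subseteq> - U"
      show "- \<mu> A \<le> 0"
      proof (rule ccontr)
        assume "\<not> - \<mu> A \<le> 0"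
        then have neg: "\<mu> A < 0" by (simp add: not_le ereal_less_uminus_reorder)
        then obtain C where C: "nonpositive_set \<mu> C" "C \<subseteq> A" "\<mu> C \<le> \<mu> A"
          using nonpositive_subset_exists[OF \<mu> noMInf A(1)] by (metis ereal_infty_less(1) less_asym)
        have Cb: "C \<in> sets borel" using C by (simp add: nonpositive_set_def)
        have "nonpositive_set \<mu> (\<Union>n. if n = (0::nat) then U else C)"
          using U C by (intro nonpositive_set_UN[OF \<mu>]) auto
        also have "(\<Union>n. if n = (0::nat) then U else C) = U \<union> C" by (auto split: if_splits)
        finally have "\<mu> U \<le> \<mu> (U \<union> C)" by (rule least)
        also have "\<dots> = \<mu> U + \<mu> C"
          using Ub Cb C A by (intro signed_borel_measure_Un[OF \<mu>]) auto
        finally have "\<mu> U \<le> \<mu> U + \<mu> C" .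
        moreover have "\<mu> U \<le> 0" using U Ub by (auto simp: nonpositive_set_def)
        moreover have "\<mu> C < 0" using C(3) neg by (rule le_less_trans)
        ultimately show False
          using noMInf[OF Ub] by (cases "\<mu> U" "\<mu> C" rule: ereal2_cases) auto
      qed
    qed
  qed
qed

lemma hahn_decomposition:
  fixes \<mu> :: "'a::topological_space set \<Rightarrow> ereal"
  assumes \<mu>: "signed_borel_measure \<mu>"
  obtains S where "nonpositive_set (\<lambda>A. - \<mu> A) S" "nonpositive_set \<mu> (- S)"
proof (cases "\<exists>A\<in>sets borel. \<mu> A = -\<infinity>")
  case False
  then obtain B where "nonpositive_set \<mu> B" "nonpositive_set (\<lambda>A. - \<mu> A) (- B)"
    using hahn_decomposition_noMInf[OF \<mu>] by blast
  then show thesis using that[of "- B"] by simp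
next
  case True
  then have "- \<mu> A \<noteq> -\<infinity>" if "A \<in> sets borel" for A
    using \<mu> that by (auto simp: signed_borel_measure_def)
  then obtain B where "nonpositive_set (\<lambda>A. - \<mu> A) B" "nonpositive_set (\<lambda>A. - (- \<mu> A)) (- B)"
    using hahn_decomposition_noMInf[OF signed_borel_measure_uminus[OF \<mu>]] by blast
  then show thesis using that by simp
qed

section \<open>Existence and uniqueness of the Jordan decomposition\<close>

lemma positive_part_measure:
  fixes \<mu> :: "'a::topological_space set \<Rightarrow> ereal"
  assumes \<mu>: "signed_borel_measure \<mu>" and S: "nonpositive_set (\<lambda>A. - \<mu> A) S"
  obtains P where "sets P = sets borel" "\<And>A. A \<in> sets borel \<Longrightarrow> enn2ereal (emeasure P A) = \<mu> (A \<inter> S)"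
proof -
  have Sb: "S \<in> sets borel" using S by (simp add: nonpositive_set_def)
  have pos: "0 \<le> \<mu> (A \<inter> S)" if "A \<in> sets borel" for A
    using S that Sb unfolding nonpositive_set_def by (metis Int_lower2 ereal_uminus_le_0_iff sets.Int)
  define P where "P = measure_of UNIV (sets borel) (\<lambda>A. e2ennreal (\<mu> (A \<inter> S)))"
  have sets: "sets P = sets borel"
    unfolding P_def using sets.space_closed[of "borel :: 'a measure"] sets.sigma_sets_eq[of "borel :: 'a measure"]
    by simp
  have "emeasure P A = e2ennreal (\<mu> (A \<inter> S))" if "A \<in> sets borel" for A
  proof (rule emeasure_measure_of[OF P_def])
    show "sets borel \<subseteq> Pow (UNIV :: 'a set)" by simp
    show "A \<in> sets P" using that sets by simp
    show "positive (sets P) (\<lambda>A. e2ennreal (\<mu> (A \<inter> S)))"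
      using \<mu> e2ennreal_neg[of 0] by (simp add: positive_def signed_borel_measure_def)
    show "countably_additive (sets P) (\<lambda>A. e2ennreal (\<mu> (A \<inter> S)))"
    proof (rule countably_additiveI)
      fix A :: "nat \<Rightarrow> 'a set"
      assume "range A \<subseteq> sets P" "disjoint_family A" "(\<Union>i. A i) \<in> sets P"
      then have A: "\<And>i. A i \<in> sets borel" "disjoint_family A" using sets by auto
      have "(\<lambda>n. \<mu> (A n \<inter> S)) sums \<mu> (\<Union>n. A n \<inter> S)"
        using A Sb by (intro signed_borel_measure_sums[OF \<mu>]) (auto simp: disjoint_family_on_def)
      then have "(\<lambda>n. enn2ereal (e2ennreal (\<mu> (A n \<inter> S)))) sums enn2ereal (e2ennreal (\<mu> ((\<Union>n. A n) \<inter> S)))"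
        using pos A by (simp add: enn2ereal_e2ennreal)
      then have "(\<lambda>n. e2ennreal (\<mu> (A n \<inter> S))) sums e2ennreal (\<mu> ((\<Union>n. A n) \<inter> S))"
        by (simp only: sums_enn2ereal)
      then show "(\<Sum>i. e2ennreal (\<mu> (A i \<inter> S))) = e2ennreal (\<mu> ((\<Union>i. A i) \<inter> S))"
        by (rule sums_unique[symmetric])
    qed
  qed
  then show thesis using that[OF sets] pos by (simp add: enn2ereal_e2ennreal)
qed

lemma jordan_decomposition_exists:
  assumes \<mu>: "signed_borel_measure \<mu>"
  obtains P N where "jordan_decomposition \<mu> P N"
proof -
  obtain S where S: "nonpositive_set (\<lambda>A. - \<mu> A) S" "nonpositive_set \<mu> (- S)"
    by (rule hahn_decomposition[OF \<mu>])
  then have Sb: "S \<in> sets borel" by (simp add: nonpositive_set_def)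
  obtain P where P: "sets P = sets borel" "\<And>A. A \<in> sets borel \<Longrightarrow> enn2ereal (emeasure P A) = \<mu> (A \<inter> S)"
    by (rule positive_part_measure[OF \<mu> S(1)]) blast
  obtain N where N: "sets N = sets borel" "\<And>A. A \<in> sets borel \<Longrightarrow> enn2ereal (emeasure N A) = - \<mu> (A \<inter> - S)"
    by (rule positive_part_measure[OF signed_borel_measure_uminus[OF \<mu>], of "- S"]) (use S in auto)
  have 0: "\<mu> {} = 0" using \<mu> by (simp add: signed_borel_measure_def)
  have "jordan_decomposition \<mu> P N"
    unfolding jordan_decomposition_def
  proof (intro conjI bexI[OF _ Sb] ballI)
    show "emeasure P (- S) = 0" using P(2)[of "- S"] Sb 0 by (simp add: enn2ereal_eq_0)
    show "emeasure N S = 0" using N(2)[of S] Sb 0 by (simp add: enn2ereal_eq_0)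
    show "emeasure P UNIV < \<infinity> \<or> emeasure N UNIV < \<infinity>"
    proof (rule ccontr)
      assume "\<not> ?thesis"
      then have "emeasure P UNIV = top" "emeasure N UNIV = top" by (simp_all add: not_less top_unique)
      then have S_inf: "\<mu> S = \<infinity>" "- \<mu> (- S) = \<infinity>"
        using P(2)[of UNIV] N(2)[of UNIV] by simp_all
      then have "\<mu> S = \<infinity>" "\<mu> (- S) = -\<infinity>" by (simp, cases "\<mu> (- S)") simp_all
      moreover have "- S \<in> sets borel" using Sb by auto
      ultimately show False using \<mu> Sb unfolding signed_borel_measure_def by blast
    qed
    fix A :: "'a set" assume A: "A \<in> sets borel"
    have "\<mu> A = \<mu> (A \<inter> S) + \<mu> (A - A \<inter> S)"
      using A Sb by (intro signed_borel_measure_split[OF \<mu>]) auto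
    moreover have "A - A \<inter> S = A \<inter> - S" by auto
    ultimately show "\<mu> A = enn2ereal (emeasure P A) - enn2ereal (emeasure N A)"
      using P(2)[OF A] N(2)[OF A] by (simp add: minus_ereal_def)
  qed (use P N in auto)
  then show thesis by (rule that)
qed

lemma jordan_decomposition_uminus:
  assumes "jordan_decomposition \<mu> P N"
  shows "jordan_decomposition (\<lambda>A. - \<mu> A) N P"
proof -
  have PN: "sets P = sets borel" "sets N = sets borel" using assms by (auto simp: jordan_decomposition_def)
  have UN: "space P = UNIV" "space N = UNIV" using PN[THEN sets_eq_imp_space_eq] by auto
  obtain S where S: "S \<in> sets borel" "emeasure P (- S) = 0" "emeasure N S = 0"
    using assms by (auto simp: jordan_decomposition_def)
  have fin: "emeasure P UNIV < \<infinity> \<or> emeasure N UNIV < \<infinity>"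
    and \<mu>: "\<And>A. A \<in> sets borel \<Longrightarrow> \<mu> A = enn2ereal (emeasure P A) - enn2ereal (emeasure N A)"
    using assms by (auto simp: jordan_decomposition_def)
  show ?thesis
    unfolding jordan_decomposition_def
  proof (intro conjI ballI)
    show "\<exists>S\<in>sets borel. emeasure N (- S) = 0 \<and> emeasure P S = 0"
      using S by (intro bexI[of _ "- S"]) auto
    fix A :: "'a set" assume A: "A \<in> sets borel"
    have "emeasure P A \<noteq> top \<or> emeasure N A \<noteq> top"
      using fin emeasure_space[of P A] emeasure_space[of N A] UN by (auto simp: top_unique)
    then show "- \<mu> A = enn2ereal (emeasure N A) - enn2ereal (emeasure P A)"
      unfolding \<mu>[OF A] by (intro ereal_minus_diff_eq) auto
  qed (use PN fin in auto)
qed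

text \<open>On \<open>S - S'\<close> one decomposition makes \<open>\<mu>\<close> equal to
  \<open>P\<close>, the other makes it equal to minus \<open>N'\<close>, so \<open>P\<close>
  vanishes there. Hence \<open>P\<close> is \<open>\<mu>\<close> restricted to
  \<open>S \<inter> S'\<close>, an expression symmetric in the two decompositions.\<close>

lemma jordan_decomposition_unique_pos:
  assumes J: "jordan_decomposition \<mu> P N" and J': "jordan_decomposition \<mu> P' N'"
  shows "P = P'"
proof -
  obtain S where S: "S \<in> sets borel" "emeasure P (- S) = 0" "emeasure N S = 0"
    using J by (auto simp: jordan_decomposition_def)
  obtain S' where S': "S' \<in> sets borel" "emeasure P' (- S') = 0" "emeasure N' S' = 0"
    using J' by (auto simp: jordan_decomposition_def)
  have half: "enn2ereal (emeasure P A) = \<mu> (A \<inter> (S \<inter> S'))"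
    if J: "jordan_decomposition \<mu> P N" and J': "jordan_decomposition \<mu> P' N'"
    and S: "S \<in> sets borel" "emeasure P (- S) = 0" "emeasure N S = 0"
    and S': "S' \<in> sets borel" "emeasure P' (- S') = 0" "emeasure N' S' = 0" and A: "A \<in> sets borel"
    for A S S' :: "'a set" and P N P' N'
  proof -
    have PN: "sets P = sets borel" "sets N = sets borel" "sets P' = sets borel" "sets N' = sets borel"
      and \<mu>: "\<And>A. A \<in> sets borel \<Longrightarrow> \<mu> A = enn2ereal (emeasure P A) - enn2ereal (emeasure N A)"
        "\<And>A. A \<in> sets borel \<Longrightarrow> \<mu> A = enn2ereal (emeasure P' A) - enn2ereal (emeasure N' A)"
      using J J' by (auto simp: jordan_decomposition_def)
    let ?X = "A \<inter> S - S'"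
    have X: "?X \<in> sets borel" using A S S' by auto
    have "emeasure N ?X = 0" "emeasure P' ?X = 0"
      using emeasure_mono[of ?X S N] emeasure_mono[of ?X "- S'" P'] S S' PN by auto
    then have "enn2ereal (emeasure P ?X) = 0 - enn2ereal (emeasure N' ?X)"
      using \<mu>[OF X] by (simp add: zero_ennreal.rep_eq)
    also have "\<dots> \<le> 0" using enn2ereal_nonneg[of "emeasure N' ?X"] by (simp add: minus_ereal_def)
    finally have PX: "emeasure P ?X = 0"
      using enn2ereal_nonneg[of "emeasure P ?X"] by (simp add: enn2ereal_eq_0 antisym)
    let ?Y = "A \<inter> (S \<inter> S')"
    have Y: "?Y \<in> sets borel" using A S S' by auto
    have "emeasure P (?X \<union> - S) \<le> emeasure P ?X + emeasure P (- S)"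
      using X S PN by (intro emeasure_subadditive) auto
    then have null: "?X \<union> - S \<in> null_sets P" using PX S X PN by (auto simp: null_sets_def)
    have "emeasure P A = emeasure P (A - (?X \<union> - S))"
      using null A PN by (simp add: emeasure_Diff_null_set)
    also have "A - (?X \<union> - S) = ?Y" by auto
    finally have "emeasure P A = emeasure P ?Y" .
    moreover have "emeasure N ?Y = 0" using emeasure_mono[of ?Y S N] S PN by auto
    ultimately show ?thesis using \<mu>(1)[OF Y] by (simp add: zero_ennreal.rep_eq)
  qed
  show ?thesis
  proof (rule measure_eqI)
    show sets: "sets P = sets P'" using J J' by (auto simp: jordan_decomposition_def)
    fix A assume "A \<in> sets P"
    then have A: "A \<in> sets borel" using J by (auto simp: jordan_decomposition_def)
    have "enn2ereal (emeasure P A) = enn2ereal (emeasure P' A)"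
      using half[OF J J' S S' A] half[OF J' J S' S A] by (simp add: Int_commute)
    then show "emeasure P A = emeasure P' A" by (simp add: enn2ereal_inject)
  qed
qed

text \<open>Uniqueness of the negative part is that of the positive part of the negated measure. It
  then suffices to exhibit some Jordan decomposition in order to compute the variations, which is
  how those of \<open>\<mu>hat\<close> are found.\<close>

lemma jordan_decomposition_variations:
  assumes J: "jordan_decomposition \<mu> P N"
  shows "pos_variation \<mu> = P" "neg_variation \<mu> = N"
proof -
  show "pos_variation \<mu> = P"
    unfolding pos_variation_def using J jordan_decomposition_unique_pos[OF _ J] by (intro the_equality) blast+
  have "N' = N" if "jordan_decomposition \<mu> P' N'" for P' N'
    using that J by (intro jordan_decomposition_unique_pos[of "\<lambda>A. - \<mu> A"] jordan_decomposition_uminus)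
  then show "neg_variation \<mu> = N"
    unfolding neg_variation_def using J by (intro the_equality) blast+
qed

lemma signed_borel_measure_diff:
  assumes P: "sets P = sets borel" and N: "sets N = sets borel"
    and fin: "emeasure P UNIV < \<infinity> \<or> emeasure N UNIV < \<infinity>"
    and \<mu>: "\<And>A. A \<in> sets borel \<Longrightarrow> \<mu> A = enn2ereal (emeasure P A) - enn2ereal (emeasure N A)"
  shows "signed_borel_measure \<mu>"
proof -
  have UN: "space P = UNIV" "space N = UNIV" using sets_eq_imp_space_eq[OF P] sets_eq_imp_space_eq[OF N] by simp_all
  from fin have fin': "(\<forall>A. emeasure P A \<noteq> top) \<or> (\<forall>A. emeasure N A \<noteq> top)"
    using emeasure_space[of P] emeasure_space[of N] unfolding UN by (metis infinity_ennreal_def less_irrefl top_unique)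
  have Minf: "enn2ereal x \<noteq> -\<infinity>" for x using enn2ereal_nonneg[of x] by auto
  show ?thesis
    unfolding signed_borel_measure_def
  proof (intro conjI allI impI)
    show "\<mu> {} = 0" by (simp add: \<mu> zero_ennreal.rep_eq)
    have "emeasure P A = top" if "A \<in> sets borel" "\<mu> A = \<infinity>" for A
      using that \<mu>[OF that(1)] Minf[of "emeasure N A"]
      by (cases "enn2ereal (emeasure P A)" "enn2ereal (emeasure N A)" rule: ereal2_cases) auto
    moreover have "emeasure N A = top" if "A \<in> sets borel" "\<mu> A = -\<infinity>" for A
      using that \<mu>[OF that(1)] Minf[of "emeasure P A"]
      by (cases "enn2ereal (emeasure P A)" "enn2ereal (emeasure N A)" rule: ereal2_cases) auto
    ultimately show "\<not> ((\<exists>A\<in>sets borel. \<mu> A = \<infinity>) \<and> (\<exists>A\<in>sets borel. \<mu> A = - \<infinity>))"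
      using fin' by blast
    fix A :: "nat \<Rightarrow> 'a set" assume A: "range A \<subseteq> sets borel" "disjoint_family A"
    let ?a = "\<lambda>n. enn2ereal (emeasure P (A n))" and ?b = "\<lambda>n. enn2ereal (emeasure N (A n))"
    have a: "?a sums enn2ereal (emeasure P (\<Union>n. A n))" and b: "?b sums enn2ereal (emeasure N (\<Union>n. A n))"
      using A P N summableI[of "\<lambda>n. emeasure P (A n)"] summableI[of "\<lambda>n. emeasure N (A n)"]
      unfolding sums_enn2ereal by (simp_all add: sums_iff suminf_emeasure)
    have part: "(\<Sum>i<n. \<mu> (A i)) = (\<Sum>i<n. ?a i) - (\<Sum>i<n. ?b i)" for n
    proof -
      \<comment> \<open>This rearrangement fails on \<open>ereal\<close> when \<infinity> meets
        -\<infinity>. Finiteness of one of the two measures keeps one of the two sums free of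
        infinite terms.\<close>
      have *: "(w - x) + (y - z) = (w + y) - (x + z)"
        if "0 \<le> w" "0 \<le> x" "0 \<le> y" "0 \<le> z" "w \<noteq> \<infinity> \<and> y \<noteq> \<infinity> \<or> x \<noteq> \<infinity> \<and> z \<noteq> \<infinity>" for w x y z :: ereal
        using that by (cases w x rule: ereal2_cases; cases y z rule: ereal2_cases) auto
      have fs: "(\<forall>n. (\<Sum>i<n. ?a i) \<noteq> \<infinity> \<and> ?a n \<noteq> \<infinity>) \<or> (\<forall>n. (\<Sum>i<n. ?b i) \<noteq> \<infinity> \<and> ?b n \<noteq> \<infinity>)"
        using fin' by (auto simp: sum_Pinfty)
      show ?thesis
      proof (induction n)
        case (Suc n)
        have "(\<Sum>i<Suc n. \<mu> (A i)) = ((\<Sum>i<n. ?a i) - (\<Sum>i<n. ?b i)) + (?a n - ?b n)"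
          using Suc A(1) \<mu>[of "A n"] by auto
        also have "\<dots> = (\<Sum>i<Suc n. ?a i) - (\<Sum>i<Suc n. ?b i)"
          using fs by (simp only: sum.lessThan_Suc) (intro * sum_nonneg enn2ereal_nonneg, blast)
        finally show ?case .
      qed simp
    qed
    have "(\<Union>n. A n) \<in> sets borel" using A(1) by auto
    moreover have "(\<lambda>n. (\<Sum>i<n. ?a i) - (\<Sum>i<n. ?b i)) \<longlonglongrightarrow>
        enn2ereal (emeasure P (\<Union>n. A n)) - enn2ereal (emeasure N (\<Union>n. A n))"
      using a b fin' unfolding sums_def by (intro tendsto_diff_ereal_general) (auto simp: Minf)
    ultimately show "(\<lambda>n. \<mu> (A n)) sums \<mu> (\<Union>n. A n)"
      unfolding sums_def part using \<mu> by simp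
  qed
qed

subsection \<open>The packing construction\<close>

lemma packing_subset:
  assumes "packing U \<delta> F" "G \<subseteq> F"
  shows "packing U \<delta> G"
  using assms unfolding packing_def disjoint_def
  by (meson Union_mono countable_subset dual_order.trans subsetD)

lemma packing_mono:
  assumes "packing U \<delta> F" "U \<subseteq> V" "\<delta> \<le> \<epsilon>"
  shows "packing V \<epsilon> F"
  using assms unfolding packing_def by (meson dual_order.trans less_le_trans)

text \<open>A nonnegative sum is the supremum of its finite partial sums, and a subfamily of a
  packing is a packing. From here on only finite packings have to be handled.\<close>

lemma packing_premeasure_finite:
  "packing_premeasure q \<delta> U = (SUP F\<in>{F. finite F \<and> packing U \<delta> F}. \<Sum>B\<in>F. q B)"
proof (rule antisym)
  show "packing_premeasure q \<delta> U \<le> (SUP F\<in>{F. finite F \<and> packing U \<delta> F}. \<Sum>B\<in>F. q B)"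
    unfolding packing_premeasure_def
  proof (rule SUP_least)
    fix F assume "F \<in> {F. packing U \<delta> F}"
    then have F: "packing U \<delta> F" by simp
    have "infsum q F = (SUP G\<in>{G. finite G \<and> G \<subseteq> F}. sum q G)"
      by (rule nonneg_infsum_complete) simp
    also have "\<dots> \<le> (SUP F\<in>{F. finite F \<and> packing U \<delta> F}. \<Sum>B\<in>F. q B)"
      using packing_subset[OF F] by (intro SUP_subset_mono) auto
    finally show "infsum q F \<le> (SUP F\<in>{F. finite F \<and> packing U \<delta> F}. \<Sum>B\<in>F. q B)" .
  qed
  show "(SUP F\<in>{F. finite F \<and> packing U \<delta> F}. \<Sum>B\<in>F. q B) \<le> packing_premeasure q \<delta> U"
    unfolding packing_premeasure_def
  proof (rule SUP_least)
    fix F assume "F \<in> {F. finite F \<and> packing U \<delta> F}"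
    then show "sum q F \<le> (SUP F\<in>{F. packing U \<delta> F}. infsum q F)"
      by (intro SUP_upper2[of F]) auto
  qed
qed

lemma sum_le_packing_premeasure:
  assumes "finite F" "packing U \<delta> F"
  shows "(\<Sum>B\<in>F. q B) \<le> packing_premeasure q \<delta> U"
  unfolding packing_premeasure_finite using assms by (intro SUP_upper) simp

lemma packing_premeasure_mono:
  assumes "U \<subseteq> V" "\<delta> \<le> \<epsilon>"
  shows "packing_premeasure q \<delta> U \<le> packing_premeasure q \<epsilon> V"
  unfolding packing_premeasure_def using packing_mono[OF _ assms] by (intro SUP_subset_mono) auto

lemma packing_open_le_premeasure:
  "\<delta> > 0 \<Longrightarrow> packing_open q U \<le> packing_premeasure q \<delta> U"
  unfolding packing_open_def by (intro INF_lower) simp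

lemma packing_open_mono:
  "U \<subseteq> V \<Longrightarrow> packing_open q U \<le> packing_open q V"
  unfolding packing_open_def by (intro INF_mono) (auto intro: packing_premeasure_mono)

lemma packing_measure_le_open:
  "open U \<Longrightarrow> A \<subseteq> U \<Longrightarrow> packing_measure q A \<le> packing_open q U"
  unfolding packing_measure_def by (intro INF_lower) simp

lemma packing_measure_open:
  assumes "open U"
  shows "packing_measure q U = packing_open q U"
proof (rule antisym)
  show "packing_measure q U \<le> packing_open q U" using assms by (rule packing_measure_le_open) simp
  show "packing_open q U \<le> packing_measure q U"
    unfolding packing_measure_def by (intro INF_greatest) (auto intro: packing_open_mono)
qed

lemma packing_measure_mono:
  "A \<subseteq> B \<Longrightarrow> packing_measure q A \<le> packing_measure q B"
  unfolding packing_measure_def by (intro INF_superset_mono) auto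

lemma packing_premeasure_tendsto:
  "(\<lambda>n. packing_premeasure q (1 / Suc n) U) \<longlonglongrightarrow> packing_open q U"
proof -
  have "decseq (\<lambda>n. packing_premeasure q (1 / Suc n) U)"
    unfolding decseq_def by (intro allI impI packing_premeasure_mono divide_left_mono) auto
  then have "(\<lambda>n. packing_premeasure q (1 / Suc n) U) \<longlonglongrightarrow> (INF n. packing_premeasure q (1 / Suc n) U)"
    by (rule LIMSEQ_INF)
  also have "(INF n. packing_premeasure q (1 / Suc n) U) = packing_open q U"
  proof (rule antisym)
    show "packing_open q U \<le> (INF n. packing_premeasure q (1 / Suc n) U)"
      by (intro INF_greatest packing_open_le_premeasure) simp
    show "(INF n. packing_premeasure q (1 / Suc n) U) \<le> packing_open q U"
      unfolding packing_open_def
    proof (rule INF_greatest)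
      fix \<delta> :: real assume "\<delta> \<in> {0<..}"
      then obtain n where n: "1 / Suc n < \<delta>" using nat_approx_posE[of \<delta>] by auto
      have "(INF n. packing_premeasure q (1 / Suc n) U) \<le> packing_premeasure q (1 / Suc n) U"
        by (rule INF_lower) simp
      also have "\<dots> \<le> packing_premeasure q \<delta> U" using n by (intro packing_premeasure_mono) auto
      finally show "(INF n. packing_premeasure q (1 / Suc n) U) \<le> packing_premeasure q \<delta> U" .
    qed
  qed
  finally show ?thesis .
qed

text \<open>Packings of disjoint sets combine to a packing of any set that contains both. This
  superadditivity needs no measure for comparison.\<close>

lemma packing_open_disjoint_add:
  assumes "U \<inter> V = {}" "U \<subseteq> W" "V \<subseteq> W"
  shows "packing_open q U + packing_open q V \<le> packing_open q W"
  unfolding packing_open_def[of q W]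
proof (rule INF_greatest)
  fix \<delta> :: real assume "\<delta> \<in> {0<..}"
  then have \<delta>: "\<delta> > 0" by simp
  let ?S = "\<lambda>U. {F. finite F \<and> packing U \<delta> F}"
  have ne: "?S U \<noteq> {}" for U :: "'a set"
  proof -
    have "{} \<in> ?S U" by (simp add: packing_def)
    then show ?thesis by blast
  qed
  have "packing_open q U + packing_open q V \<le> packing_premeasure q \<delta> U + packing_premeasure q \<delta> V"
    using \<delta> by (intro add_mono packing_open_le_premeasure)
  also have "\<dots> = (SUP F\<in>?S U. sum q F + packing_premeasure q \<delta> V)"
    unfolding packing_premeasure_finite[of q \<delta> U] by (rule ennreal_SUP_add_left[symmetric, OF ne])
  also have "\<dots> \<le> packing_premeasure q \<delta> W"
  proof (rule SUP_least)
    fix F assume F: "F \<in> ?S U"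
    have "sum q F + packing_premeasure q \<delta> V = (SUP G\<in>?S V. sum q G + sum q F)"
      unfolding packing_premeasure_finite[of q \<delta> V] by (subst ennreal_SUP_add_left[OF ne]) (rule add.commute)
    also have "\<dots> \<le> packing_premeasure q \<delta> W"
    proof (rule SUP_least)
      fix G assume G: "G \<in> ?S V"
      have sub: "\<Union>F \<subseteq> U" "\<Union>G \<subseteq> V" using F G by (auto simp: packing_def)
      \<comment> \<open>A common member would lie in \<open>U \<inter> V\<close> and be empty, but a
        ball of positive radius contains its centre.\<close>
      have "F \<inter> G = {}"
      proof (rule ccontr)
        assume "F \<inter> G \<noteq> {}"
        then obtain B where B: "B \<in> F" "B \<in> G" by blast
        then obtain x r where "0 < r" "B = cball x r" using F by (auto simp: packing_def)
        then have "x \<in> B" by simp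
        then show False using B sub assms(1) by blast
      qed
      then have "sum q G + sum q F = sum q (F \<union> G)"
        using F G by (subst sum.union_disjoint) (auto simp: add.commute)
      also have "\<dots> \<le> packing_premeasure q \<delta> W"
        using F G by (intro sum_le_packing_premeasure packing_union[OF _ _ assms]) auto
      finally show "sum q G + sum q F \<le> packing_premeasure q \<delta> W" .
    qed
    finally show "sum q F + packing_premeasure q \<delta> V \<le> packing_premeasure q \<delta> W" .
  qed
  finally show "packing_open q U + packing_open q V \<le> packing_premeasure q \<delta> W" .
qed

text \<open>The open \<epsilon>-neighbourhood of the complement of \<open>U\<close>; its part inside
  \<open>U\<close> is the boundary layer. A closed ball of radius below \<delta> that is not
  contained in \<open>U\<close> lies in the collar of width \<open>2 * \<delta>\<close>.\<close>

definition outer_collar :: "'a::metric_space set \<Rightarrow> real \<Rightarrow> 'a set" where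
  "outer_collar U \<epsilon> = (\<Union>y\<in>-U. ball y \<epsilon>)"

lemma open_outer_collar: "open (outer_collar U \<epsilon>)"
  by (auto simp: outer_collar_def)

lemma outer_collar_mono: "\<delta> \<le> \<epsilon> \<Longrightarrow> outer_collar U \<delta> \<subseteq> outer_collar U \<epsilon>"
  by (auto simp: outer_collar_def)

lemma Compl_subset_outer_collar: "\<epsilon> > 0 \<Longrightarrow> - U \<subseteq> outer_collar U \<epsilon>"
  by (auto simp: outer_collar_def intro!: bexI)

lemma not_in_closure_outer_collar:
  assumes "open U" "x \<in> U"
  obtains \<epsilon> where "\<epsilon> > 0" "\<And>\<delta>. \<delta> \<le> \<epsilon> \<Longrightarrow> x \<notin> closure (outer_collar U \<delta>)"
proof -
  obtain e where e: "e > 0" "ball x e \<subseteq> U" using assms openE by blast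
  show thesis
  proof (rule that[of "e / 2"])
    show "e / 2 > 0" using e by simp
    fix \<delta> assume \<delta>: "\<delta> \<le> e / 2"
    have "ball x (e / 2) \<inter> outer_collar U \<delta> = {}"
    proof (rule ccontr)
      assume "ball x (e / 2) \<inter> outer_collar U \<delta> \<noteq> {}"
      then obtain z y where z: "dist x z < e / 2" "y \<notin> U" "dist y z < \<delta>" by (auto simp: outer_collar_def)
      then have "dist x y < e" using dist_triangle2[of x y z] \<delta> by (simp add: dist_commute)
      then show False using e z by auto
    qed
    then have "outer_collar U \<delta> \<subseteq> - ball x (e / 2)" by blast
    then have "closure (outer_collar U \<delta>) \<subseteq> - ball x (e / 2)"
      by (rule closure_minimal) (simp add: closed_def)
    then show "x \<notin> closure (outer_collar U \<delta>)" using e by auto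
  qed
qed

lemma vanishing_closure_outer_collar:
  assumes "open U"
  shows "(\<Inter>n. U \<inter> closure (outer_collar U (1 / Suc n))) = {}"
proof -
  have "\<exists>n. x \<notin> closure (outer_collar U (1 / Suc n))" if "x \<in> U" for x
  proof -
    obtain \<epsilon> where \<epsilon>: "\<epsilon> > 0" "\<And>\<delta>. \<delta> \<le> \<epsilon> \<Longrightarrow> x \<notin> closure (outer_collar U \<delta>)"
      using not_in_closure_outer_collar[OF assms \<open>x \<in> U\<close>] by blast
    obtain n where "1 / Suc n < \<epsilon>" using nat_approx_posE[OF \<epsilon>(1)] by blast
    then show ?thesis using \<epsilon>(2)[of "1 / Suc n"] by auto
  qed
  then show ?thesis by blast
qed

text \<open>A locally finite measure \<open>P\<close> that controls the packing construction from above on balls and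
  from below on open sets makes it countably subadditive.\<close>

locale packing_comparison =
  fixes P :: "'a::metric_space measure" and q :: "'a set \<Rightarrow> ennreal" and C \<kappa> :: real
  assumes sets_P: "sets P = sets borel"
    and finite_bounded: "\<And>A. A \<in> sets borel \<Longrightarrow> bounded A \<Longrightarrow> emeasure P A < \<infinity>"
    and upper: "\<And>x r. r > 0 \<Longrightarrow> q (cball x r) \<le> ennreal C * emeasure P (cball x r)"
    and \<kappa>: "\<kappa> > 0"
    and lower: "\<And>U. open U \<Longrightarrow> ennreal \<kappa> * emeasure P U \<le> packing_open q U"
begin

lemma sum_le_emeasure:
  assumes "packing U \<delta> F" "finite F" "\<Union>F \<subseteq> D" "D \<in> sets borel"
  shows "(\<Sum>B\<in>F. q B) \<le> ennreal C * emeasure P D"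
proof -
  have "(\<Sum>B\<in>F. q B) \<le> (\<Sum>B\<in>F. ennreal C * emeasure P B)"
  proof (rule sum_mono)
    fix B assume "B \<in> F"
    then obtain x r where "r > 0" "B = cball x r" using assms(1) by (auto simp: packing_def)
    then show "q B \<le> ennreal C * emeasure P B" using upper by simp
  qed
  also have "\<dots> \<le> ennreal C * emeasure P D"
    unfolding sum_distrib_left[symmetric]
    using sum_packing_le_emeasure[OF sets_P assms] by (intro mult_left_mono) auto
  finally show ?thesis .
qed

lemma packing_open_le:
  assumes "open U"
  shows "packing_open q U \<le> ennreal C * emeasure P U"
proof -
  have "packing_open q U \<le> packing_premeasure q 1 U" by (rule packing_open_le_premeasure) simp
  also have "\<dots> \<le> ennreal C * emeasure P U"
    unfolding packing_premeasure_finite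
    using assms by (intro SUP_least sum_le_emeasure[of U 1]) (auto simp: packing_def)
  finally show ?thesis .
qed

text \<open>Values on arbitrary sets are infima over open supersets, so the bound for open sets
  passes to Borel sets once \<open>P\<close> itself is outer regular.\<close>

lemma packing_measure_le:
  assumes A: "A \<in> sets borel"
  shows "packing_measure q A \<le> ennreal C * emeasure P A"
proof (rule ennreal_le_epsilon)
  fix e :: real assume e: "e > 0"
  \<comment> \<open>\<open>ennreal C\<close> equals \<open>ennreal (max C 0)\<close>, since the
    locale does not fix the sign of \<open>C\<close>; the summand 1 keeps the denominator
    positive.\<close>
  define d where "d = e / (max C 0 + 1)"
  have d: "d > 0" "max C 0 * d \<le> e" using e by (auto simp: d_def field_simps)
  obtain V where V: "open V" "A \<subseteq> V" "emeasure P V \<le> emeasure P A + ennreal d"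
    using locally_finite_borel_outer_regular[OF sets_P finite_bounded A d(1)] by blast
  have "packing_measure q A \<le> packing_open q V" using V by (intro packing_measure_le_open)
  also have "\<dots> \<le> ennreal C * emeasure P V" by (rule packing_open_le[OF V(1)])
  also have "\<dots> \<le> ennreal C * (emeasure P A + ennreal d)" using V by (intro mult_left_mono) auto
  also have "\<dots> = ennreal C * emeasure P A + ennreal (max C 0 * d)"
    using d by (simp add: distrib_left ennreal_mult' max_def ennreal_neg)
  also have "\<dots> \<le> ennreal C * emeasure P A + ennreal e"
    using d by (intro add_left_mono ennreal_leI)
  finally show "packing_measure q A \<le> ennreal C * emeasure P A + ennreal e" .
qed

lemma packing_measure_ge:
  assumes A: "A \<in> sets borel"
  shows "ennreal \<kappa> * emeasure P A \<le> packing_measure q A"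
  unfolding packing_measure_def
proof (rule INF_greatest)
  fix U assume "U \<in> {U. open U \<and> A \<subseteq> U}"
  then have U: "open U" "A \<subseteq> U" by auto
  have "ennreal \<kappa> * emeasure P A \<le> ennreal \<kappa> * emeasure P U"
    using U sets_P by (intro mult_left_mono emeasure_mono) auto
  also have "\<dots> \<le> packing_open q U" by (rule lower[OF U(1)])
  finally show "ennreal \<kappa> * emeasure P A \<le> packing_open q U" .
qed

lemma packing_measure_bounded:
  assumes "bounded A"
  shows "packing_measure q A < \<infinity>"
proof -
  obtain x r where "A \<subseteq> ball x r" using assms bounded_subset_ballD by blast
  then have "packing_measure q A \<le> packing_measure q (ball x r)" by (rule packing_measure_mono)
  also have "\<dots> \<le> ennreal C * emeasure P (ball x r)" by (rule packing_measure_le) simp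
  also have "\<dots> < \<infinity>" using finite_bounded[of "ball x r"] by (simp add: ennreal_mult_less_top)
  finally show ?thesis .
qed

section \<open>Countable subadditivity and Caratheodory measurability of open sets\<close>

lemma emeasure_finite_of_packing_open:
  assumes "open U" "packing_open q U < \<infinity>"
  shows "emeasure P U < \<infinity>"
  using le_less_trans[OF lower[OF assms(1)] assms(2)] \<kappa> by (auto simp: ennreal_mult_less_top)

text \<open>A ball that fits into one of the first \<open>m\<close> sets is charged to that set. Any
  other ball leaves each of these sets and so lies in all of their collars; as the balls are
  disjoint, the measure \<open>P\<close> bounds the total contribution of the latter kind.\<close>

lemma packing_premeasure_UN_le:
  fixes U :: "nat \<Rightarrow> 'a set"
  assumes U: "\<And>n. open (U n)" and \<delta>: "\<delta> > 0"
  shows "packing_premeasure q \<delta> (\<Union>n. U n) \<le> (\<Sum>n<m. packing_premeasure q \<delta> (U n)) +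
    ennreal C * emeasure P ((\<Union>n. U n) \<inter> (\<Inter>n\<in>{..<m}. outer_collar (U n) (2 * \<delta>)))"
    (is "_ \<le> _ + ennreal C * emeasure P ?D")
  unfolding packing_premeasure_finite[of q \<delta> "\<Union>n. U n"]
proof (rule SUP_least)
  fix F assume "F \<in> {F. finite F \<and> packing (\<Union>n. U n) \<delta> F}"
  then have F: "finite F" "packing (\<Union>n. U n) \<delta> F" by auto
  define G where "G = {B\<in>F. \<forall>n<m. \<not> B \<subseteq> U n}"
  have "sum q F \<le> (\<Sum>B\<in>F. (\<Sum>n<m. if B \<subseteq> U n then q B else 0) + (if B \<in> G then q B else 0))"
  proof (rule sum_mono)
    fix B assume B: "B \<in> F"
    show "q B \<le> (\<Sum>n<m. if B \<subseteq> U n then q B else 0) + (if B \<in> G then q B else 0)"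
    proof (cases "B \<in> G")
      case True
      then show ?thesis by (simp add: add_increasing)
    next
      case False
      with B obtain n where n: "n < m" "B \<subseteq> U n" by (auto simp: G_def)
      have "q B = (if B \<subseteq> U n then q B else 0)" using n by simp
      also have "\<dots> \<le> (\<Sum>n<m. if B \<subseteq> U n then q B else 0)"
        using n by (intro member_le_sum) auto
      finally show ?thesis by (simp add: add_increasing2)
    qed
  qed
  also have "\<dots> = (\<Sum>n<m. \<Sum>B\<in>F. if B \<subseteq> U n then q B else 0) + (\<Sum>B\<in>F. if B \<in> G then q B else 0)"
    unfolding sum.distrib by (subst sum.swap) (rule refl)
  also have "\<dots> = (\<Sum>n<m. sum q {B\<in>F. B \<subseteq> U n}) + sum q {B\<in>F. B \<in> G}"
    using F(1) by (simp add: sum.inter_filter)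
  also have "\<dots> \<le> (\<Sum>n<m. packing_premeasure q \<delta> (U n)) + ennreal C * emeasure P ?D"
  proof (intro add_mono sum_mono)
    fix n
    have "packing (U n) \<delta> {B\<in>F. B \<subseteq> U n}"
    proof -
      have "\<Union>{B\<in>F. B \<subseteq> U n} \<subseteq> U n" by blast
      then show ?thesis
        using packing_subset[OF F(2), of "{B\<in>F. B \<subseteq> U n}"] unfolding packing_def by blast
    qed
    then show "sum q {B\<in>F. B \<subseteq> U n} \<le> packing_premeasure q \<delta> (U n)"
      using F(1) by (intro sum_le_packing_premeasure) auto
  next
    show "sum q {B\<in>F. B \<in> G} \<le> ennreal C * emeasure P ?D"
    proof (rule sum_le_emeasure)
      show "packing (\<Union>n. U n) \<delta> {B\<in>F. B \<in> G}" by (rule packing_subset[OF F(2)]) auto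
      show "\<Union>{B\<in>F. B \<in> G} \<subseteq> ?D"
      proof
        fix z assume "z \<in> \<Union>{B\<in>F. B \<in> G}"
        then obtain B where B: "B \<in> F" "B \<in> G" "z \<in> B" by blast
        then obtain x r where xr: "r < \<delta>" "B = cball x r" using F(2) by (auto simp: packing_def)
        have "z \<in> outer_collar (U n) (2 * \<delta>)" if n: "n < m" for n
        proof -
          obtain y where y: "y \<in> B" "y \<notin> U n" using B(2) n by (auto simp: G_def)
          have "dist y z \<le> dist x y + dist x z" by (rule dist_triangle3)
          then have "dist y z < 2 * \<delta>" using xr B(3) y(1) by auto
          then show ?thesis using y(2) by (auto simp: outer_collar_def)
        qed
        moreover have "z \<in> (\<Union>n. U n)" using B F(2) unfolding packing_def by blast
        ultimately show "z \<in> ?D" by blast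
      qed
      have "open ((\<Inter>n\<in>{..<m}. outer_collar (U n) (2 * \<delta>)))"
        by (intro open_INT) (auto simp: open_outer_collar)
      then show "?D \<in> sets borel" using U by (intro sets.Int borel_open) auto
    qed (use F(1) in simp)
  qed
  finally show "sum q F \<le> (\<Sum>n<m. packing_premeasure q \<delta> (U n)) + ennreal C * emeasure P ?D" .
qed

text \<open>For fixed \<open>m\<close>, letting the radii tend to 0 shrinks the collars to what the
  first \<open>m\<close> sets leave uncovered; letting \<open>m\<close> grow shrinks that to the
  empty set. Both limits are continuity from above of \<open>P\<close>, whence the finiteness
  assumption.\<close>

lemma packing_open_UN_le:
  fixes U :: "nat \<Rightarrow> 'a set"
  assumes U: "\<And>n. open (U n)" and fin: "emeasure P (\<Union>n. U n) < \<infinity>"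
  shows "packing_open q (\<Union>n. U n) \<le> (\<Sum>n. packing_open q (U n))"
proof -
  let ?W = "\<Union>n. U n"
  have W: "?W \<in> sets P" using U sets_P by auto
  have fin': "emeasure P X \<noteq> \<infinity>" if "X \<subseteq> ?W" for X
    using le_less_trans[OF emeasure_mono[OF that W] fin] by simp
  have step: "packing_open q ?W \<le> (\<Sum>n. packing_open q (U n)) + ennreal C * emeasure P (?W - (\<Union>n<m. U n))" for m
  proof -
    define D where "D k = ?W \<inter> (\<Inter>n\<in>{..<m}. outer_collar (U n) (2 * (1 / Suc k)))" for k :: nat
    have D: "D k \<in> sets P" for k
    proof -
      have "open (\<Inter>n\<in>{..<m}. outer_collar (U n) (2 * (1 / Suc k)))"
        by (intro open_INT) (auto simp: open_outer_collar)
      then show ?thesis unfolding D_def sets_P using U by (intro sets.Int borel_open) auto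
    qed
    have "(\<lambda>k. emeasure P (D k)) \<longlonglongrightarrow> emeasure P (\<Inter>k. D k)"
    proof (rule Lim_emeasure_decseq)
      show "range D \<subseteq> sets P" using D by auto
      have "outer_collar (U n) (2 * (1 / Suc l)) \<subseteq> outer_collar (U n) (2 * (1 / Suc k))" if "k \<le> l" for k l n
        using that by (intro outer_collar_mono mult_left_mono divide_left_mono) auto
      then show "decseq D" unfolding decseq_def D_def by (intro allI impI Int_mono INF_superset_mono) auto
      show "emeasure P (D k) \<noteq> \<infinity>" for k by (rule fin') (auto simp: D_def)
    qed
    then have "(\<lambda>k. (\<Sum>n<m. packing_premeasure q (1 / Suc k) (U n)) + ennreal C * emeasure P (D k))
        \<longlonglongrightarrow> (\<Sum>n<m. packing_open q (U n)) + ennreal C * emeasure P (\<Inter>k. D k)"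
      by (intro tendsto_add tendsto_sum packing_premeasure_tendsto ennreal_tendsto_cmult) auto
    moreover have "packing_open q ?W \<le> (\<Sum>n<m. packing_premeasure q (1 / Suc k) (U n)) + ennreal C * emeasure P (D k)" for k
      using order_trans[OF packing_open_le_premeasure packing_premeasure_UN_le[OF U], of "1 / real (Suc k)" _ m]
      by (simp add: D_def)
    ultimately have "packing_open q ?W \<le> (\<Sum>n<m. packing_open q (U n)) + ennreal C * emeasure P (\<Inter>k. D k)"
      by (intro LIMSEQ_le_const) auto
    also have "\<dots> \<le> (\<Sum>n. packing_open q (U n)) + ennreal C * emeasure P (?W - (\<Union>n<m. U n))"
    proof (intro add_mono mult_left_mono emeasure_mono)
      show "(\<Sum>n<m. packing_open q (U n)) \<le> (\<Sum>n. packing_open q (U n))"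
        by (intro sum_le_suminf) auto
      show "(\<Inter>k. D k) \<subseteq> ?W - (\<Union>n<m. U n)"
      proof
        fix x assume x: "x \<in> (\<Inter>k. D k)"
        have "x \<notin> U n" if "n < m" for n
        proof
          assume "x \<in> U n"
          then obtain \<epsilon> where \<epsilon>: "\<epsilon> > 0" "\<And>\<delta>. \<delta> \<le> \<epsilon> \<Longrightarrow> x \<notin> closure (outer_collar (U n) \<delta>)"
            using not_in_closure_outer_collar[OF U] by blast
          obtain k where k: "1 / Suc k < \<epsilon> / 2" using nat_approx_posE[of "\<epsilon> / 2"] \<epsilon>(1) by auto
          have "x \<in> outer_collar (U n) (2 * (1 / Suc k))" using x that by (auto simp: D_def)
          then show False using \<epsilon>(2)[of "2 * (1 / Suc k)"] k closure_subset by auto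
        qed
        then show "x \<in> ?W - (\<Union>n<m. U n)" using x by (auto simp: D_def)
      qed
      show "?W - (\<Union>n<m. U n) \<in> sets P" using U W sets_P by auto
    qed auto
    finally show ?thesis .
  qed
  have "(\<lambda>m. emeasure P (?W - (\<Union>n<m. U n))) \<longlonglongrightarrow> emeasure P (\<Inter>m. ?W - (\<Union>n<m. U n))"
  proof (rule Lim_emeasure_decseq)
    show "range (\<lambda>m. ?W - (\<Union>n<m. U n)) \<subseteq> sets P" using U W sets_P by auto
    show "decseq (\<lambda>m. ?W - (\<Union>n<m. U n))"
      unfolding decseq_def by (intro allI impI Diff_mono UN_mono) auto
    show "emeasure P (?W - (\<Union>n<m. U n)) \<noteq> \<infinity>" for m by (rule fin') auto
  qed
  moreover have "(\<Inter>m. ?W - (\<Union>n<m. U n)) = {}" by auto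
  ultimately have lim: "(\<lambda>m. emeasure P (?W - (\<Union>n<m. U n))) \<longlonglongrightarrow> 0" by (simp only: emeasure_empty)
  have "(\<lambda>m. (\<Sum>n. packing_open q (U n)) + ennreal C * emeasure P (?W - (\<Union>n<m. U n)))
      \<longlonglongrightarrow> (\<Sum>n. packing_open q (U n)) + ennreal C * 0"
    by (intro tendsto_add tendsto_const ennreal_tendsto_cmult lim) simp
  then show ?thesis using step by (auto intro: LIMSEQ_le_const)
qed

lemma packing_measure_UN_le:
  "packing_measure q (\<Union>n. A n) \<le> (\<Sum>n. packing_measure q (A n))"
proof (rule ennreal_le_epsilon)
  fix e :: real assume fin: "(\<Sum>n. packing_measure q (A n)) < top" and e: "e > 0"
  have "\<exists>U. open U \<and> A n \<subseteq> U \<and> packing_open q U \<le> packing_measure q (A n) + ennreal (e * (1/2) ^ Suc n)" for n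
  proof -
    have "packing_measure q (A n) < top"
      using fin ennreal_suminf_lessD by blast
    then have "packing_measure q (A n) < packing_measure q (A n) + ennreal (e * (1/2) ^ Suc n)"
      using e by (cases "packing_measure q (A n)") (auto simp flip: ennreal_plus simp: ennreal_less_iff)
    then show ?thesis
      unfolding packing_measure_def INF_less_iff by (auto intro: less_imp_le)
  qed
  then obtain U where U: "\<And>n. open (U n)" "\<And>n. A n \<subseteq> U n"
    "\<And>n. packing_open q (U n) \<le> packing_measure q (A n) + ennreal (e * (1/2) ^ Suc n)" by metis
  have "(\<Sum>n. packing_open q (U n)) \<le> (\<Sum>n. packing_measure q (A n) + ennreal (e * (1/2) ^ Suc n))"
    using U(3) by (intro suminf_le) auto
  also have "\<dots> = (\<Sum>n. packing_measure q (A n)) + (\<Sum>n. ennreal (e * (1/2) ^ Suc n))"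
    by (intro suminf_add[symmetric]) auto
  also have "(\<Sum>n. ennreal (e * (1/2) ^ Suc n)) = ennreal e"
  proof (rule suminf_ennreal_eq)
    show "(\<lambda>i. e * (1/2) ^ Suc i) sums e"
      using sums_mult[OF power_half_series, of e] by simp
  qed (use e in auto)
  finally have sum: "(\<Sum>n. packing_open q (U n)) \<le> (\<Sum>n. packing_measure q (A n)) + ennreal e" .
  \<comment> \<open>The lower comparison bounds \<open>P\<close> by the packing values, so the open
    supersets have a union of finite measure, as the subadditivity for open sets demands.\<close>
  have "ennreal \<kappa> * (\<Sum>n. emeasure P (U n)) = (\<Sum>n. ennreal \<kappa> * emeasure P (U n))" by simp
  also have "\<dots> \<le> (\<Sum>n. packing_open q (U n))" using lower U(1) by (intro suminf_le) auto
  also have "\<dots> < top" using sum fin by (simp add: le_less_trans)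
  finally have "(\<Sum>n. emeasure P (U n)) < top" using \<kappa> by (auto simp: ennreal_mult_less_top)
  moreover have "emeasure P (\<Union>n. U n) \<le> (\<Sum>n. emeasure P (U n))"
    using U(1) sets_P by (intro emeasure_subadditive_countably) auto
  ultimately have finU: "emeasure P (\<Union>n. U n) < \<infinity>" by simp
  have "packing_measure q (\<Union>n. A n) \<le> packing_open q (\<Union>n. U n)"
    using U(1,2) by (intro packing_measure_le_open open_UN UN_mono ballI) auto
  also have "\<dots> \<le> (\<Sum>n. packing_open q (U n))" by (rule packing_open_UN_le[OF U(1) finU])
  also note sum
  finally show "packing_measure q (\<Union>n. A n) \<le> (\<Sum>n. packing_measure q (A n)) + ennreal e" .
qed

lemma packing_measure_empty: "packing_measure q {} = 0"
  using packing_measure_le[of "{}"] by simp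

lemma packing_measure_Un_le:
  "packing_measure q (A \<union> B) \<le> packing_measure q A + packing_measure q B"
proof -
  have "packing_measure q (A \<union> B) \<le> (\<Sum>n. packing_measure q (binaryset A B n))"
    using packing_measure_UN_le[of "binaryset A B"] by (simp add: UN_binaryset_eq)
  also have "\<dots> = (\<Sum>n\<in>{0, Suc 0}. packing_measure q (binaryset A B n))"
    by (intro suminf_finite) (auto simp: binaryset_def packing_measure_empty)
  finally show ?thesis by (simp add: binaryset_def)
qed

lemma outer_measure_packing: "outer_measure_space UNIV (packing_measure q)"
  unfolding outer_measure_space_def positive_def increasing_def countably_subadditive_def
  using packing_measure_empty packing_measure_mono packing_measure_UN_le by blast

text \<open>Superadditivity is available for disjoint open sets, but \<open>V - W\<close> need not
  be open. It is enlarged to the trace of a collar on \<open>V\<close>, and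
  \<open>Z = V \<inter> W\<close> is shrunk to the complement of the closed collar. What
  \<open>Z\<close> loses has \<open>P\<close>-measure tending to 0, hence also packing measure
  tending to 0.\<close>

lemma packing_measure_open_split:
  assumes W: "open W"
  shows "packing_measure q (A \<inter> W) + packing_measure q (A - W) = packing_measure q A"
proof (rule antisym)
  show "packing_measure q (A \<inter> W) + packing_measure q (A - W) \<le> packing_measure q A"
    unfolding packing_measure_def[of q A]
  proof (rule INF_greatest)
    fix V assume "V \<in> {V. open V \<and> A \<subseteq> V}"
    then have V: "open V" "A \<subseteq> V" by auto
    show "packing_measure q (A \<inter> W) + packing_measure q (A - W) \<le> packing_open q V"
    proof (cases "packing_open q V < \<infinity>")
      case False
      then show ?thesis by (simp add: not_less top_unique)
    next
      case True
      define Z where "Z = V \<inter> W"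
      have Z: "open Z" using V W by (auto simp: Z_def)
      have Zfin: "emeasure P Z < \<infinity>"
        using emeasure_finite_of_packing_open[OF V(1) True] emeasure_mono[of Z V P] V sets_P
        by (auto simp: Z_def intro: le_less_trans)
      define E where "E n = closure (outer_collar Z (1 / Suc n))" for n :: nat
      have EZ: "Z \<inter> E n \<in> sets P" for n using Z sets_P by (auto simp: E_def)
      have "(\<lambda>n. emeasure P (Z \<inter> E n)) \<longlonglongrightarrow> emeasure P (\<Inter>n. Z \<inter> E n)"
      proof (rule Lim_emeasure_decseq)
        show "range (\<lambda>n. Z \<inter> E n) \<subseteq> sets P" using EZ by auto
        show "decseq (\<lambda>n. Z \<inter> E n)"
          unfolding decseq_def E_def
          by (intro allI impI Int_mono closure_mono outer_collar_mono divide_left_mono) auto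
        show "emeasure P (Z \<inter> E n) \<noteq> \<infinity>" for n
          using le_less_trans[OF emeasure_mono[of "Z \<inter> E n" Z P] Zfin] Z sets_P by auto
      qed
      then have "(\<lambda>n. emeasure P (Z \<inter> E n)) \<longlonglongrightarrow> 0"
        unfolding E_def vanishing_closure_outer_collar[OF Z] by simp
      then have lim: "(\<lambda>n. packing_open q V + ennreal C * emeasure P (Z \<inter> E n)) \<longlonglongrightarrow> packing_open q V + ennreal C * 0"
        by (intro tendsto_add tendsto_const ennreal_tendsto_cmult) auto
      have "packing_measure q Z + packing_measure q (V - W) \<le> packing_open q V + ennreal C * emeasure P (Z \<inter> E n)" for n
      proof -
        let ?Y = "V \<inter> outer_collar Z (1 / Suc n)"
        have coll: "- Z \<subseteq> outer_collar Z (1 / Suc n)" by (rule Compl_subset_outer_collar) simp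
        then have VW: "V - W \<subseteq> ?Y" by (auto simp: Z_def)
        have sub: "outer_collar Z (1 / Suc n) \<subseteq> E n" unfolding E_def by (rule closure_subset)
        have YZ: "open ?Y" "open (- E n)" using V by (auto simp: open_outer_collar E_def)
        have "packing_measure q Z \<le> packing_measure q ((- E n) \<union> (Z \<inter> E n))"
          by (rule packing_measure_mono) auto
        also have "\<dots> \<le> packing_measure q (- E n) + packing_measure q (Z \<inter> E n)"
          by (rule packing_measure_Un_le)
        also have "\<dots> \<le> packing_open q (- E n) + ennreal C * emeasure P (Z \<inter> E n)"
          using packing_measure_open[OF YZ(2)] packing_measure_le[of "Z \<inter> E n"] EZ sets_P
          by (intro add_mono) auto
        finally have "packing_measure q Z + packing_measure q (V - W)
            \<le> (packing_open q (- E n) + ennreal C * emeasure P (Z \<inter> E n)) + packing_open q ?Y"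
          using packing_measure_le_open[OF YZ(1) VW] by (intro add_mono)
        also have "\<dots> = (packing_open q (- E n) + packing_open q ?Y) + ennreal C * emeasure P (Z \<inter> E n)"
          by (simp add: ac_simps)
        also have "\<dots> \<le> packing_open q V + ennreal C * emeasure P (Z \<inter> E n)"
        proof (intro add_right_mono packing_open_disjoint_add)
          show "- E n \<inter> ?Y = {}" using sub by blast
          have "- E n \<subseteq> Z" using sub coll by blast
          then show "- E n \<subseteq> V" by (auto simp: Z_def)
        qed auto
        finally show ?thesis .
      qed
      then have "packing_measure q Z + packing_measure q (V - W) \<le> packing_open q V"
        using LIMSEQ_le_const[OF lim] by auto
      moreover have "packing_measure q (A \<inter> W) + packing_measure q (A - W)
          \<le> packing_measure q Z + packing_measure q (V - W)"
        using V by (intro add_mono packing_measure_mono) (auto simp: Z_def)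
      ultimately show ?thesis by (rule order_trans[rotated])
    qed
  qed
  have "packing_measure q A = packing_measure q ((A \<inter> W) \<union> (A - W))"
    by (rule arg_cong[where f = "packing_measure q"]) auto
  also have "\<dots> \<le> packing_measure q (A \<inter> W) + packing_measure q (A - W)"
    by (rule packing_measure_Un_le)
  finally show "packing_measure q A \<le> packing_measure q (A \<inter> W) + packing_measure q (A - W)" .
qed

text \<open>The neighbourhood of \<open>E\<close> of width \<open>setdist E F\<close> is open,
  contains \<open>E\<close> and misses \<open>F\<close>; cutting the union with it separates the two
  sets.\<close>

lemma metric_outer_measure_packing: "metric_outer_measure (packing_measure q)"
  unfolding metric_outer_measure_def
proof (intro conjI allI impI outer_measure_packing)
  fix E F :: "'a set" assume pos: "setdist E F > 0"
  define W where "W = (\<Union>x\<in>E. ball x (setdist E F))"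
  have "open W" by (auto simp: W_def)
  have "E \<subseteq> W" using pos by (auto simp: W_def intro!: bexI)
  moreover have "F \<inter> W = {}"
  proof -
    have False if "x \<in> E" "y \<in> F" "dist x y < setdist E F" for x y
      using setdist_le_dist[OF that(1,2)] that(3) by simp
    then show ?thesis by (fastforce simp: W_def)
  qed
  ultimately have "(E \<union> F) \<inter> W = E" "(E \<union> F) - W = F" by auto
  then show "packing_measure q (E \<union> F) = packing_measure q E + packing_measure q F"
    using packing_measure_open_split[OF \<open>open W\<close>, of "E \<union> F"] by simp
qed

text \<open>The Caratheodory measurable sets form a sigma-algebra that contains the open sets, hence
  the Borel sets. A value of type \<open>measure\<close> is wanted for the Jordan decomposition of
  the difference.\<close>

lemma packing_measure_borel:
  obtains M where "sets M = sets borel" "\<And>A. A \<in> sets borel \<Longrightarrow> emeasure M A = packing_measure q A"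
proof -
  let ?L = "lambda_system UNIV UNIV (packing_measure q)"
  have sig: "sigma_algebra UNIV (UNIV :: 'a set set)"
    using sigma_algebra_Pow[of "UNIV :: 'a set"] by simp
  have L: "measure_space UNIV ?L (packing_measure q)"
    by (rule sigma_algebra.caratheodory_lemma[OF sig outer_measure_packing])
  have "{U. open U} \<subseteq> ?L"
    using packing_measure_open_split by (auto simp: lambda_system_def Int_commute Compl_eq_Diff_UNIV[symmetric] Diff_eq)
  then have "sigma_sets UNIV {U. open U} \<subseteq> ?L"
    using L unfolding measure_space_def by (intro sigma_algebra.sigma_sets_subset) auto
  then have sub: "sets borel \<subseteq> ?L" by (simp add: borel_def sets_measure_of)
  define M where "M = measure_of UNIV (sets borel) (packing_measure q)"
  have sets: "sets M = sets borel"
    unfolding M_def using sets.space_closed[of "borel :: 'a measure"] sets.sigma_sets_eq[of "borel :: 'a measure"]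
    by simp
  have ca: "countably_additive ?L (packing_measure q)" using L by (simp add: measure_space_def)
  have "emeasure M A = packing_measure q A" if "A \<in> sets borel" for A
  proof (rule emeasure_measure_of[OF M_def])
    show "sets borel \<subseteq> Pow (UNIV :: 'a set)" by simp
    show "A \<in> sets M" using that sets by simp
    show "positive (sets M) (packing_measure q)" by (simp add: positive_def packing_measure_empty)
    show "countably_additive (sets M) (packing_measure q)"
      using ca sub unfolding countably_additive_def sets by blast
  qed
  then show thesis using that sets by blast
qed

end

subsection \<open>Lower bound on open sets\<close>

lemma emeasure_cball_eq_measure:
  fixes P :: "'a::metric_space measure"
  assumes "\<And>A. A \<in> sets borel \<Longrightarrow> bounded A \<Longrightarrow> emeasure P A < \<infinity>"
  shows "emeasure P (cball x r) = ennreal (measure P (cball x r))"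
  using assms[of "cball x r"] by (intro emeasure_eq_ennreal_measure) auto

text \<open>Almost all of \<open>A\<close> can be filled by disjoint balls inside \<open>U\<close>
  on which the inequality holds, so it passes to \<open>A\<close> and \<open>U\<close> without a
  covering constant. This one-sided estimate takes the place of a differentiation theorem; it is
  applied with \<open>M\<close> being \<nu> and being the singular measure \<open>N\<close>.\<close>

lemma vitali_comparison:
  fixes A :: "'a::metric_space set"
  assumes sep: "separable_space (euclidean :: 'a topology)"
    and lim: "directionally_limited TYPE('a)"
    and P: "sets P = sets borel" "\<And>A. A \<in> sets borel \<Longrightarrow> bounded A \<Longrightarrow> emeasure P A < \<infinity>"
    and M: "sets M = sets borel" "\<And>A. A \<in> sets borel \<Longrightarrow> bounded A \<Longrightarrow> emeasure M A < \<infinity>"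
    and U: "open U" "emeasure P U < \<infinity>" "A \<subseteq> U" and t: "t \<ge> 0"
    and fine: "\<And>x \<epsilon>. x \<in> A \<Longrightarrow> \<epsilon> > 0 \<Longrightarrow>
      \<exists>r. 0 < r \<and> r < \<epsilon> \<and> measure P (cball x r) \<le> t * measure M (cball x r)"
  shows "outer_measure_of P A \<le> ennreal t * emeasure M U"
proof (rule ennreal_le_epsilon)
  fix e :: real assume e: "e > 0"
  have fine': "\<exists>r. 0 < r \<and> r < \<epsilon> \<and> emeasure P (cball x r) \<le> ennreal t * emeasure M (cball x r)"
    if x: "x \<in> A" "\<epsilon> > 0" for x \<epsilon>
  proof -
    obtain r where r: "0 < r" "r < \<epsilon>" "measure P (cball x r) \<le> t * measure M (cball x r)"
      using fine[OF x] by blast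
    have "emeasure P (cball x r) \<le> ennreal (t * measure M (cball x r))"
      using r(3) by (simp add: emeasure_cball_eq_measure[OF P(2)] ennreal_leI)
    also have "\<dots> = ennreal t * emeasure M (cball x r)"
      using t by (simp add: emeasure_cball_eq_measure[OF M(2)] ennreal_mult)
    finally show ?thesis using r by blast
  qed
  obtain F where F: "finite F" "packing U 1 F"
    "\<And>B. B \<in> F \<Longrightarrow> emeasure P B \<le> ennreal t * emeasure M B"
    "outer_measure_of P A \<le> (\<Sum>B\<in>F. emeasure P B) + ennreal e"
    by (rule vitali_packing[OF sep lim P(1) U zero_less_one, where e = e
          and Q = "\<lambda>B. emeasure P B \<le> ennreal t * emeasure M B"]) (use fine' e in auto)
  note F(4)
  also have "(\<Sum>B\<in>F. emeasure P B) \<le> (\<Sum>B\<in>F. ennreal t * emeasure M B)" by (rule sum_mono) (rule F(3))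
  also have "\<dots> = ennreal t * (\<Sum>B\<in>F. emeasure M B)" by (simp add: sum_distrib_left)
  also have "\<dots> \<le> ennreal t * emeasure M U"
    using F U(1) by (intro mult_left_mono sum_packing_le_emeasure[OF M(1)]) (auto simp: packing_def)
  finally show "outer_measure_of P A \<le> ennreal t * emeasure M U + ennreal e" by (simp add: add_right_mono)
qed

lemma outer_null_subset_null_set:
  assumes "sets P = sets borel" "outer_measure_of P A = 0"
  obtains Z where "Z \<in> null_sets P" "A \<subseteq> Z"
  using outer_measure_of_attain[of A P] sets_eq_imp_space_eq[OF assms(1)] assms(2)
  by (auto simp: null_sets_def)

text \<open>If \<open>P\<close> gained more than the factor \<open>\<gamma>'\<close> at each step of the scales \<open>\<alpha> ^ k * r\<close>, while \<open>\<nu>\<close> gains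
  less than some \<open>\<gamma>'' < \<gamma>'\<close>, the ratio of \<open>P\<close> to \<open>\<nu>\<close> would decay geometrically.\<close>

lemma no_doubling_small_ratio:
  fixes \<nu> P :: "'a::metric_space measure"
  assumes \<nu>: "asymptotically_bounded \<alpha> \<gamma> \<nu>" and \<alpha>: "0 < \<alpha>" "\<alpha> \<le> 1" and \<gamma>: "1 \<le> \<gamma>" "\<gamma> < \<gamma>'"
    and \<rho>: "\<rho> > 0"
    and big: "\<And>r. 0 < r \<Longrightarrow> r < \<rho> \<Longrightarrow> \<gamma>' * measure P (cball x (\<alpha> * r)) < measure P (cball x r)"
    and t: "t > 0" and \<delta>: "\<delta> > 0"
  shows "\<exists>r. 0 < r \<and> r < \<delta> \<and> measure P (cball x r) \<le> t * measure \<nu> (cball x r)"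
proof -
  have fin: "A \<in> sets borel \<Longrightarrow> bounded A \<Longrightarrow> emeasure \<nu> A < \<infinity>" for A
    using \<nu> by (auto simp: asymptotically_bounded_def)
  note em = emeasure_cball_eq_measure[OF fin]
  have pos: "measure \<nu> (cball x r) > 0" if "r > 0" for r
  proof -
    have "emeasure \<nu> (cball x r) > 0" using \<nu> that by (auto simp: asymptotically_bounded_def)
    then show ?thesis using em by simp
  qed
  \<comment> \<open>By \<open>\<gamma> < g\<close> the limsup bound yields the factor
    \<open>g\<close> at all small radii; by \<open>g < \<gamma>'\<close> each step from
    \<open>r\<close> to \<open>\<alpha> * r\<close> multiplies the ratio of \<open>P\<close> to
    \<nu> by at most \<open>g / \<gamma>' < 1\<close>.\<close>
  define g where "g = (\<gamma> + \<gamma>') / 2"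
  have g: "\<gamma> < g" "g < \<gamma>'" "g > 0" using \<gamma> by (auto simp: g_def)
  have "Limsup (at_right 0) (\<lambda>r. emeasure \<nu> (cball x r) / emeasure \<nu> (cball x (\<alpha> * r))) \<le> ennreal \<gamma>"
    using \<nu> by (simp add: asymptotically_bounded_def)
  also have "\<dots> < ennreal g" using g \<gamma> by (simp add: ennreal_less_iff)
  finally have "\<forall>\<^sub>F r in at_right 0. emeasure \<nu> (cball x r) / emeasure \<nu> (cball x (\<alpha> * r)) < ennreal g"
    by (rule Limsup_lessD)
  then obtain b where b: "b > 0"
    "\<And>r. 0 < r \<Longrightarrow> r < b \<Longrightarrow> emeasure \<nu> (cball x r) / emeasure \<nu> (cball x (\<alpha> * r)) < ennreal g"
    unfolding eventually_at_right_field by blast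
  have dbl: "measure \<nu> (cball x r) \<le> g * measure \<nu> (cball x (\<alpha> * r))" if "0 < r" "r < b" for r
  proof -
    have p: "measure \<nu> (cball x (\<alpha> * r)) > 0" using pos that \<alpha> by simp
    have "ennreal (measure \<nu> (cball x r) / measure \<nu> (cball x (\<alpha> * r))) < ennreal g"
      using b(2)[OF that] p by (simp add: em divide_ennreal)
    then have "measure \<nu> (cball x r) / measure \<nu> (cball x (\<alpha> * r)) < g"
      by (subst (asm) ennreal_less_iff) auto
    then show ?thesis using p by (simp add: field_simps)
  qed
  define s where "s = min \<rho> (min b \<delta>) / 2"
  have s: "0 < s" "s < \<rho>" "s < b" "s < \<delta>" using \<rho> b(1) \<delta> by (auto simp: s_def min_def)
  have sk: "0 < \<alpha> ^ k * s" "\<alpha> ^ k * s \<le> s" for k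
    using s(1) \<alpha> by (auto simp: mult_le_cancel_right1 power_le_one)
  have "measure P (cball x (\<alpha> ^ k * s)) * \<gamma>' ^ k \<le> measure P (cball x s)" for k
  proof (induction k)
    case (Suc k)
    have "\<gamma>' * measure P (cball x (\<alpha> ^ Suc k * s)) \<le> measure P (cball x (\<alpha> ^ k * s))"
      using big[of "\<alpha> ^ k * s"] sk[of k] s by (simp add: mult.assoc)
    then have "\<gamma>' * measure P (cball x (\<alpha> ^ Suc k * s)) * \<gamma>' ^ k \<le> measure P (cball x (\<alpha> ^ k * s)) * \<gamma>' ^ k"
      using \<gamma> by (intro mult_right_mono) auto
    with Suc show ?case by (simp add: mult_ac)
  qed simp
  moreover have "measure \<nu> (cball x s) \<le> g ^ k * measure \<nu> (cball x (\<alpha> ^ k * s))" for k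
  proof (induction k)
    case (Suc k)
    have "measure \<nu> (cball x (\<alpha> ^ k * s)) \<le> g * measure \<nu> (cball x (\<alpha> ^ Suc k * s))"
      using dbl[of "\<alpha> ^ k * s"] sk[of k] s by (simp add: mult.assoc)
    then have "g ^ k * measure \<nu> (cball x (\<alpha> ^ k * s)) \<le> g ^ k * (g * measure \<nu> (cball x (\<alpha> ^ Suc k * s)))"
      using g by (intro mult_left_mono) auto
    with Suc show ?case by (simp add: mult_ac)
  qed simp
  moreover have "\<exists>k. (g / \<gamma>') ^ k * measure P (cball x s) < t * measure \<nu> (cball x s)"
  proof -
    have "(\<lambda>k. (g / \<gamma>') ^ k * measure P (cball x s)) \<longlonglongrightarrow> 0 * measure P (cball x s)"
      using g \<gamma> by (intro tendsto_mult tendsto_const LIMSEQ_power_zero) auto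
    then have "\<forall>\<^sub>F k in sequentially. (g / \<gamma>') ^ k * measure P (cball x s) < t * measure \<nu> (cball x s)"
      using t pos[OF s(1)] by (intro order_tendstoD(2)) auto
    then show ?thesis by (auto simp: eventually_sequentially)
  qed
  ultimately obtain k where
    k1: "measure P (cball x (\<alpha> ^ k * s)) * \<gamma>' ^ k \<le> measure P (cball x s)" and
    k2: "measure \<nu> (cball x s) \<le> g ^ k * measure \<nu> (cball x (\<alpha> ^ k * s))" and
    k3: "(g / \<gamma>') ^ k * measure P (cball x s) < t * measure \<nu> (cball x s)" by blast
  have g': "g ^ k > 0" "\<gamma>' ^ k > 0" using g \<gamma> by auto
  have "g ^ k * measure P (cball x (\<alpha> ^ k * s)) \<le> g ^ k * (measure P (cball x s) / \<gamma>' ^ k)"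
    using k1 g' by (intro mult_left_mono) (auto simp: field_simps)
  also have "\<dots> = (g / \<gamma>') ^ k * measure P (cball x s)" by (simp add: power_divide)
  also have "\<dots> \<le> t * (g ^ k * measure \<nu> (cball x (\<alpha> ^ k * s)))"
    using k3 mult_left_mono[OF k2, of t] t by linarith
  finally have "g ^ k * measure P (cball x (\<alpha> ^ k * s)) \<le> g ^ k * (t * measure \<nu> (cball x (\<alpha> ^ k * s)))"
    by (simp add: mult_ac)
  then have "measure P (cball x (\<alpha> ^ k * s)) \<le> t * measure \<nu> (cball x (\<alpha> ^ k * s))"
    using g'(1) by (subst (asm) mult_le_cancel_left_pos) auto
  then show ?thesis using sk[of k] s(4) by (intro exI[of _ "\<alpha> ^ k * s"]) auto
qed

text \<open>At almost every point, arbitrarily small balls satisfy \<open>P (B\<^sub>r) \<le> \<gamma>' * P (B\<^bsub>\<alpha>r\<^esub>)\<close> for a given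
  \<open>\<gamma>' > \<gamma>\<close>, and all sufficiently small ones satisfy \<open>N (B\<^sub>r) \<le> \<epsilon> * P (B\<^sub>r)\<close> because \<open>N\<close> is singular to
  \<open>P\<close>.  On such balls \<open>q\<close> is almost at least \<open>P / (\<gamma> C)\<close>, and they can be packed.\<close>

lemma packing_open_lower_bounded:
  fixes P N \<nu> :: "'a::metric_space measure"
  assumes sep: "separable_space (euclidean :: 'a topology)"
    and lim: "directionally_limited TYPE('a)"
    and \<nu>: "asymptotically_bounded \<alpha> \<gamma> \<nu>" and \<alpha>: "0 < \<alpha>" "\<alpha> \<le> 1" and \<gamma>: "1 \<le> \<gamma>"
    and P: "sets P = sets borel" "\<And>A. A \<in> sets borel \<Longrightarrow> bounded A \<Longrightarrow> emeasure P A < \<infinity>"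
    and N: "sets N = sets borel" "\<And>A. A \<in> sets borel \<Longrightarrow> bounded A \<Longrightarrow> emeasure N A < \<infinity>"
    and S: "S \<in> sets borel" "emeasure P (- S) = 0" "emeasure N S = 0"
    and C: "C \<ge> 1"
    and q: "\<And>x r. r > 0 \<Longrightarrow>
      ennreal (1 / C * measure P (cball x (\<alpha> * r)) - measure N (cball x r)) \<le> q (cball x r)"
    and U: "open U" "bounded U" and \<kappa>: "0 < \<kappa>" "\<kappa> < 1 / (\<gamma> * C)"
  shows "ennreal \<kappa> * emeasure P U \<le> packing_open q U"
proof -
  have \<nu>_sets: "sets \<nu> = sets borel" and \<nu>_fin: "\<And>A. A \<in> sets borel \<Longrightarrow> bounded A \<Longrightarrow> emeasure \<nu> A < \<infinity>"
    using \<nu> by (auto simp: asymptotically_bounded_def)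
  have Ub: "U \<in> sets borel" and PU: "emeasure P U < \<infinity>" and NU: "emeasure \<nu> U < \<infinity>"
    using U P(2) \<nu>_fin by auto
  \<comment> \<open>The strict inequality for \<open>\<kappa>\<close> leaves room for
    \<open>\<gamma> < \<gamma>' < 1 / (C * \<kappa>)\<close>, and \<open>\<epsilon>\<close> below is
    the resulting margin. A ball that doubles with factor \<open>\<gamma>'\<close> and has
    \<open>N\<close> below \<open>\<epsilon>\<close> times \<open>P\<close> gets from the bound on
    \<open>q\<close> at least \<open>(1 / (C * \<gamma>') - \<epsilon>) = \<kappa>\<close> times its
    \<open>P\<close>-measure.\<close>
  define \<gamma>' where "\<gamma>' = (\<gamma> + 1 / (C * \<kappa>)) / 2"
  have "\<gamma> < 1 / (C * \<kappa>)" using \<kappa> \<gamma> C by (simp add: field_simps)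
  then have \<gamma>': "\<gamma> < \<gamma>'" "\<gamma>' < 1 / (C * \<kappa>)" by (auto simp: \<gamma>'_def)
  define \<epsilon> where "\<epsilon> = 1 / (C * \<gamma>') - \<kappa>"
  have \<epsilon>: "\<epsilon> > 0" using \<gamma>' \<gamma> \<kappa> C by (simp add: \<epsilon>_def field_simps)
  \<comment> \<open>The two kinds of bad points: doubling fails at all small radii, or
    \<open>N\<close> is not negligible at arbitrarily small radii. Their measurability is not
    established, so they are treated with outer measures and null supersets.\<close>
  define A1 where "A1 = {x\<in>U. \<exists>\<rho>>0. \<forall>r. 0 < r \<longrightarrow> r < \<rho> \<longrightarrow>
      \<gamma>' * measure P (cball x (\<alpha> * r)) < measure P (cball x r)}"
  define A2 where "A2 = {x\<in>U \<inter> S. \<forall>\<rho>>0. \<exists>r. 0 < r \<and> r < \<rho> \<and>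
      measure P (cball x r) \<le> 1 / \<epsilon> * measure N (cball x r)}"
  have A1_le: "outer_measure_of P A1 \<le> ennreal e" if e: "e > 0" for e
  proof -
    \<comment> \<open>At points of \<open>A1\<close> the ratio of \<open>P\<close> to \<nu> gets
      below every positive number, so \<open>t\<close> is free to be chosen with
      \<open>t * measure \<nu> U \<le> e\<close>.\<close>
    define t where "t = e / (measure \<nu> U + 1)"
    have "measure \<nu> U + 1 > 0" using measure_nonneg[of \<nu> U] by linarith
    then have t: "t > 0" "t * measure \<nu> U \<le> e"
      using e by (simp_all add: t_def pos_divide_le_eq)
    have "outer_measure_of P A1 \<le> ennreal t * emeasure \<nu> U"
    proof (rule vitali_comparison[OF sep lim P \<nu>_sets \<nu>_fin U(1) PU])
      fix \<delta> :: real and y :: 'a assume y: "y \<in> A1" "\<delta> > 0"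
      then obtain \<rho> where "\<rho> > 0" "\<And>r. 0 < r \<Longrightarrow> r < \<rho> \<Longrightarrow>
          \<gamma>' * measure P (cball y (\<alpha> * r)) < measure P (cball y r)"
        unfolding A1_def by blast
      then show "\<exists>r. 0 < r \<and> r < \<delta> \<and> measure P (cball y r) \<le> t * measure \<nu> (cball y r)"
        by (rule no_doubling_small_ratio[OF \<nu> \<alpha> \<gamma> \<gamma>'(1) _ _ t(1) y(2)])
    qed (use t in \<open>auto simp: A1_def\<close>)
    also have "\<dots> = ennreal (t * measure \<nu> U)"
      using t NU by (simp add: emeasure_eq_ennreal_measure ennreal_mult)
    also have "\<dots> \<le> ennreal e" using t by (intro ennreal_leI)
    finally show ?thesis .
  qed
  have "outer_measure_of P A1 \<le> 0"
  proof (rule ennreal_le_epsilon)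
    show "outer_measure_of P A1 \<le> 0 + ennreal e" if "e > 0" for e
      using A1_le[OF that] by (simp only: add_0)
  qed
  then obtain Z1 where Z1: "Z1 \<in> null_sets P" "A1 \<subseteq> Z1"
    using outer_null_subset_null_set[OF P(1), of A1] by auto
  have A2_le: "outer_measure_of P A2 \<le> ennreal e" if e: "e > 0" for e
  proof -
    \<comment> \<open>Singularity enters here: \<open>N\<close> vanishes on \<open>S\<close>, so an
      open set around \<open>U \<inter> S\<close> has \<open>N\<close>-measure at most
      \<open>e * \<epsilon>\<close>, which cancels the factor \<open>1 / \<epsilon>\<close> from
      \<open>A2\<close>.\<close>
    obtain V where V: "open V" "U \<inter> S \<subseteq> V" "emeasure N V \<le> emeasure N (U \<inter> S) + ennreal (e * \<epsilon>)"
      using locally_finite_borel_outer_regular[OF N, of "U \<inter> S" "e * \<epsilon>"] Ub S(1) e \<epsilon> by auto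
    have "emeasure N (U \<inter> S) \<le> emeasure N S" using S(1) N(1) by (intro emeasure_mono) auto
    then have "emeasure N V \<le> ennreal (e * \<epsilon>)" using V(3) S(3) by simp
    moreover have "emeasure N (V \<inter> U) \<le> emeasure N V" using V(1) N(1) by (intro emeasure_mono) auto
    ultimately have NV: "emeasure N (V \<inter> U) \<le> ennreal (e * \<epsilon>)" by (rule order_trans[rotated])
    have PV: "emeasure P (V \<inter> U) < \<infinity>" using P(2)[of "V \<inter> U"] V(1) U by auto
    have "outer_measure_of P A2 \<le> ennreal (1 / \<epsilon>) * emeasure N (V \<inter> U)"
      by (rule vitali_comparison[OF sep lim P N _ PV]) (use V U \<epsilon> in \<open>auto simp: A2_def\<close>)
    also have "\<dots> \<le> ennreal (1 / \<epsilon>) * ennreal (e * \<epsilon>)" by (intro mult_left_mono NV) simp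
    also have "\<dots> = ennreal e" using \<epsilon> e by (simp flip: ennreal_mult)
    finally show ?thesis .
  qed
  have "outer_measure_of P A2 \<le> 0"
  proof (rule ennreal_le_epsilon)
    show "outer_measure_of P A2 \<le> 0 + ennreal e" if "e > 0" for e
      using A2_le[OF that] by (simp only: add_0)
  qed
  then obtain Z2 where Z2: "Z2 \<in> null_sets P" "A2 \<subseteq> Z2"
    using outer_null_subset_null_set[OF P(1), of A2] by auto
  define Z where "Z = Z1 \<union> Z2 \<union> - S"
  have Z: "Z \<in> null_sets P"
    unfolding Z_def using Z1 Z2 S P(1) by (intro null_sets.Un) (auto simp: null_sets_def)
  have AB: "U - Z \<in> sets P" using Z Ub P(1) by (auto simp: null_sets_def)
  have fine: "\<exists>r. 0 < r \<and> r < \<delta> \<and> ennreal \<kappa> * emeasure P (cball x r) \<le> q (cball x r)"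
    if x: "x \<in> U - Z" and \<delta>: "\<delta> > 0" for x \<delta>
  proof -
    have "x \<notin> A1" "x \<notin> A2" "x \<in> S" "x \<in> U" using x Z1(2) Z2(2) by (auto simp: Z_def)
    then obtain \<rho> where \<rho>: "\<rho> > 0" "\<And>r. 0 < r \<Longrightarrow> r < \<rho> \<Longrightarrow>
        1 / \<epsilon> * measure N (cball x r) < measure P (cball x r)"
      unfolding A2_def by (auto simp: not_le)
    have "min \<rho> \<delta> > 0" using \<rho> \<delta> by simp
    with \<open>x \<notin> A1\<close> \<open>x \<in> U\<close> obtain r where r: "0 < r" "r < min \<rho> \<delta>"
      "measure P (cball x r) \<le> \<gamma>' * measure P (cball x (\<alpha> * r))"
      unfolding A1_def by (fastforce simp: not_less simp del: min_less_iff_conj)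
    have "measure N (cball x r) < \<epsilon> * measure P (cball x r)"
      using \<rho>(2)[of r] r \<epsilon> by (simp add: field_simps)
    moreover have "measure P (cball x r) / (C * \<gamma>') \<le> \<gamma>' * measure P (cball x (\<alpha> * r)) / (C * \<gamma>')"
      using r(3) C \<gamma> \<gamma>' by (intro divide_right_mono) auto
    then have "1 / (C * \<gamma>') * measure P (cball x r) \<le> 1 / C * measure P (cball x (\<alpha> * r))"
      using \<gamma> \<gamma>' by simp
    ultimately have "\<kappa> * measure P (cball x r) \<le> 1 / C * measure P (cball x (\<alpha> * r)) - measure N (cball x r)"
      unfolding \<epsilon>_def by (simp add: left_diff_distrib)
    then have "ennreal (\<kappa> * measure P (cball x r)) \<le> q (cball x r)"
      using order_trans[OF ennreal_leI q[OF r(1), of x]] by blast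
    moreover have "ennreal (\<kappa> * measure P (cball x r)) = ennreal \<kappa> * emeasure P (cball x r)"
      using \<kappa> by (simp add: emeasure_cball_eq_measure[OF P(2)] ennreal_mult)
    ultimately show ?thesis using r by auto
  qed
  show ?thesis
    unfolding packing_open_def
  proof (rule INF_greatest)
    fix \<delta> :: real assume "\<delta> \<in> {0<..}"
    then have \<delta>: "\<delta> > 0" by simp
    show "ennreal \<kappa> * emeasure P U \<le> packing_premeasure q \<delta> U"
    proof (rule ennreal_le_epsilon)
      fix e :: real assume e: "e > 0"
      obtain F where F: "finite F" "packing U \<delta> F"
        "\<And>B. B \<in> F \<Longrightarrow> ennreal \<kappa> * emeasure P B \<le> q B"
        "outer_measure_of P (U - Z) \<le> (\<Sum>B\<in>F. emeasure P B) + ennreal (e / \<kappa>)"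
        by (rule vitali_packing[OF sep lim P(1) U(1) PU _ \<delta>, where A = "U - Z" and e = "e / \<kappa>"
              and Q = "\<lambda>B. ennreal \<kappa> * emeasure P B \<le> q B"]) (use fine e \<kappa> in auto)
      have "emeasure P U = emeasure P (U - Z)"
        using Z Ub P(1) by (intro emeasure_Diff_null_set[symmetric]) auto
      also have "\<dots> = outer_measure_of P (U - Z)" using AB by (rule outer_measure_of_eq[symmetric])
      finally have "ennreal \<kappa> * emeasure P U \<le> ennreal \<kappa> * ((\<Sum>B\<in>F. emeasure P B) + ennreal (e / \<kappa>))"
        using F(4) by (intro mult_left_mono) auto
      also have "\<dots> = (\<Sum>B\<in>F. ennreal \<kappa> * emeasure P B) + ennreal e"
        using \<kappa> e by (simp add: distrib_left sum_distrib_left flip: ennreal_mult)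
      also have "\<dots> \<le> (\<Sum>B\<in>F. q B) + ennreal e" by (intro add_right_mono sum_mono F(3))
      also have "\<dots> \<le> packing_premeasure q \<delta> U + ennreal e"
        by (intro add_right_mono sum_le_packing_premeasure F(1,2))
      finally show "ennreal \<kappa> * emeasure P U \<le> packing_premeasure q \<delta> U + ennreal e" .
    qed
  qed
qed

text \<open>At the endpoint \<open>1 / (\<gamma> * C)\<close> no margin is left. On bounded open
  sets, where \<open>P\<close> is finite, a failure at the endpoint would already be a failure at
  some smaller \<open>\<kappa>\<close>. Exhaustion by balls then gives the general case through
  continuity from below of \<open>P\<close>.\<close>

lemma packing_open_lower:
  fixes P N \<nu> :: "'a::metric_space measure"
  assumes sep: "separable_space (euclidean :: 'a topology)"
    and lim: "directionally_limited TYPE('a)"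
    and \<nu>: "asymptotically_bounded \<alpha> \<gamma> \<nu>" and \<alpha>: "0 < \<alpha>" "\<alpha> \<le> 1" and \<gamma>: "1 \<le> \<gamma>"
    and P: "sets P = sets borel" "\<And>A. A \<in> sets borel \<Longrightarrow> bounded A \<Longrightarrow> emeasure P A < \<infinity>"
    and N: "sets N = sets borel" "\<And>A. A \<in> sets borel \<Longrightarrow> bounded A \<Longrightarrow> emeasure N A < \<infinity>"
    and S: "S \<in> sets borel" "emeasure P (- S) = 0" "emeasure N S = 0"
    and C: "C \<ge> 1"
    and q: "\<And>x r. r > 0 \<Longrightarrow>
      ennreal (1 / C * measure P (cball x (\<alpha> * r)) - measure N (cball x r)) \<le> q (cball x r)"
    and U: "open U"
  shows "ennreal (1 / (\<gamma> * C)) * emeasure P U \<le> packing_open q U"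
proof -
  have c0: "1 / (\<gamma> * C) > 0" using \<gamma> C by simp
  have bdd: "ennreal (1 / (\<gamma> * C)) * emeasure P V \<le> packing_open q V" if V: "open V" "bounded V" for V
  proof (rule ccontr)
    assume "\<not> ?thesis"
    then have less: "packing_open q V < ennreal (1 / (\<gamma> * C)) * emeasure P V" by simp
    have PV: "emeasure P V = ennreal (measure P V)"
      using P(2)[of V] V by (intro emeasure_eq_ennreal_measure) auto
    obtain y where y: "packing_open q V = ennreal y" "y \<ge> 0"
      using less by (cases "packing_open q V") auto
    have yc: "y < 1 / (\<gamma> * C) * measure P V"
      using less c0 y by (simp add: PV ennreal_less_iff flip: ennreal_mult)
    then have mpos: "measure P V > 0" using y(2) by (cases "measure P V = 0") (auto simp: less_le)
    then have "y / measure P V < 1 / (\<gamma> * C)" using yc by (simp only: pos_divide_less_eq)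
    then obtain \<kappa> where \<kappa>: "y / measure P V < \<kappa>" "\<kappa> < 1 / (\<gamma> * C)" using dense by blast
    have \<kappa>0: "\<kappa> > 0" using \<kappa>(1) y(2) mpos by (smt (verit) divide_nonneg_pos)
    have "ennreal \<kappa> * emeasure P V \<le> packing_open q V"
      by (rule packing_open_lower_bounded[OF sep lim \<nu> \<alpha> \<gamma> P N S C q V \<kappa>0 \<kappa>(2)])
    then have "\<kappa> * measure P V \<le> y"
      using \<kappa>0 y by (simp add: PV flip: ennreal_mult)
    then show False using \<kappa>(1) mpos by (simp add: pos_divide_less_eq)
  qed
  fix x0 :: 'a
  have inc: "incseq (\<lambda>n::nat. U \<inter> ball x0 (real n))" by (auto simp: incseq_def)
  have "(\<Union>n::nat. U \<inter> ball x0 (real n)) = U"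
    using reals_Archimedean2 by (auto simp: subset_eq)
  moreover have "range (\<lambda>n::nat. U \<inter> ball x0 (real n)) \<subseteq> sets P" unfolding P(1) using U by auto
  ultimately have "emeasure P U = (SUP n::nat. emeasure P (U \<inter> ball x0 (real n)))"
    using SUP_emeasure_incseq[OF _ inc, of P] by simp
  then have "ennreal (1 / (\<gamma> * C)) * emeasure P U =
      (SUP n::nat. ennreal (1 / (\<gamma> * C)) * emeasure P (U \<inter> ball x0 (real n)))"
    by (simp add: SUP_mult_left_ennreal)
  also have "\<dots> \<le> packing_open q U"
  proof (rule SUP_least)
    fix n :: nat
    have "ennreal (1 / (\<gamma> * C)) * emeasure P (U \<inter> ball x0 (real n)) \<le> packing_open q (U \<inter> ball x0 (real n))"
      using U by (intro bdd) (auto intro: bounded_Int)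
    also have "\<dots> \<le> packing_open q U" by (rule packing_open_mono) auto
    finally show "ennreal (1 / (\<gamma> * C)) * emeasure P (U \<inter> ball x0 (real n)) \<le> packing_open q U" .
  qed
  finally show ?thesis .
qed

text \<open>\<open>ennreal\<close> truncates negative numbers to 0, so a lower bound that may be
  negative becomes an inequality in \<open>ennreal\<close>. As the variations are finite on balls,
  the subtraction can be done in the reals.\<close>

lemma ennreal_le_of_ereal_diff_le:
  assumes "ereal c * enn2ereal (ennreal a) - enn2ereal (ennreal b) \<le> enn2ereal z" "0 \<le> a" "0 \<le> b"
  shows "ennreal (c * a - b) \<le> z"
proof -
  have "ereal (c * a - b) \<le> enn2ereal z" using assms by simp
  then have "e2ennreal (ereal (c * a - b)) \<le> e2ennreal (enn2ereal z)" by (rule e2ennreal_mono)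
  then show ?thesis by simp
qed

theorem theorem3p9:
  fixes \<nu> :: "'a::metric_space measure"
    and \<mu> :: "'a set \<Rightarrow> ereal"
    and qp qn :: "'a set \<Rightarrow> ennreal"
    and \<alpha> \<gamma> C :: real
  defines "\<mu>hat \<equiv> \<lambda>A. enn2ereal (packing_measure qp A) - enn2ereal (packing_measure qn A)"
  assumes separable: "separable_space (euclidean :: 'a topology)"
    and dir_limited: "directionally_limited TYPE('a)"
    and alpha: "0 < \<alpha>" "\<alpha> \<le> 1"
    and gamma: "\<gamma> \<ge> 1"
    and nu: "asymptotically_bounded \<alpha> \<gamma> \<nu>"
    and mu: "signed_borel_measure \<mu>" "locally_finite_signed \<mu>" "borel_regular_signed \<mu>"
    and C: "C \<ge> 1"
    and qp_empty: "qp {} = 0"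
    and qn_empty: "qn {} = 0"
    and qp_lower: "\<And>x r. r > 0 \<Longrightarrow>
          ereal (1 / C) * enn2ereal (emeasure (pos_variation \<mu>) (cball x (\<alpha> * r)))
            - enn2ereal (emeasure (neg_variation \<mu>) (cball x r))
          \<le> enn2ereal (qp (cball x r))"
    and qp_upper: "\<And>x r. r > 0 \<Longrightarrow>
          qp (cball x r) \<le> ennreal C * emeasure (pos_variation \<mu>) (cball x r)"
    and qn_lower: "\<And>x r. r > 0 \<Longrightarrow>
          ereal (1 / C) * enn2ereal (emeasure (neg_variation \<mu>) (cball x (\<alpha> * r)))
            - enn2ereal (emeasure (pos_variation \<mu>) (cball x r))
          \<le> enn2ereal (qn (cball x r))"
    and qn_upper: "\<And>x r. r > 0 \<Longrightarrow>
          qn (cball x r) \<le> ennreal C * emeasure (neg_variation \<mu>) (cball x r)"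
  shows "(metric_outer_measure (packing_measure qp) \<and>
          metric_outer_measure (packing_measure qn) \<and>
          (\<forall>A. bounded A \<longrightarrow> packing_measure qp A < \<infinity> \<and> packing_measure qn A < \<infinity>)) \<and>
         (signed_borel_measure \<mu>hat \<and>
          (\<forall>A\<in>sets borel.
             ennreal (1 / (\<gamma> * C)) * emeasure (pos_variation \<mu>) A \<le> packing_measure qp A \<and>
             packing_measure qp A \<le> ennreal C * emeasure (pos_variation \<mu>) A \<and>
             ennreal (1 / (\<gamma> * C)) * emeasure (neg_variation \<mu>) A \<le> packing_measure qn A \<and>
             packing_measure qn A \<le> ennreal C * emeasure (neg_variation \<mu>) A \<and>
             ennreal (1 / (\<gamma> * C)) * total_variation \<mu> A \<le> total_variation \<mu>hat A \<and>
             total_variation \<mu>hat A \<le> ennreal C * total_variation \<mu> A))"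
proof -
  define P where "P = pos_variation \<mu>"
  define N where "N = neg_variation \<mu>"
  obtain P0 N0 where "jordan_decomposition \<mu> P0 N0" by (rule jordan_decomposition_exists[OF mu(1)])
  then have J: "jordan_decomposition \<mu> P N"
    using jordan_decomposition_variations unfolding P_def N_def by metis
  then have sP: "sets P = sets borel" and sN: "sets N = sets borel"
    and fin: "emeasure P UNIV < \<infinity> \<or> emeasure N UNIV < \<infinity>"
    by (auto simp: jordan_decomposition_def)
  obtain S where S: "S \<in> sets borel" "emeasure P (- S) = 0" "emeasure N S = 0"
    using J by (auto simp: jordan_decomposition_def)
  \<comment> \<open>With \<open>- S\<close> in place of \<open>S\<close> the roles of
    \<open>P\<close> and \<open>N\<close> are exchanged, which serves the negative sign.\<close>
  have S': "- S \<in> sets borel" "emeasure N (- (- S)) = 0" "emeasure P (- S) = 0" using S by auto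
  have fin_bounded: "emeasure P A + emeasure N A < \<infinity>" if "A \<in> sets borel" "bounded A" for A
    using mu(2) that unfolding locally_finite_signed_def total_variation_def P_def N_def by blast
  have fP: "emeasure P A < \<infinity>" and fN: "emeasure N A < \<infinity>" if "A \<in> sets borel" "bounded A" for A
    using fin_bounded[OF that] by auto
  have eP: "emeasure P (cball x r) = ennreal (measure P (cball x r))" for x r
    by (rule emeasure_cball_eq_measure[OF fP])
  have eN: "emeasure N (cball x r) = ennreal (measure N (cball x r))" for x r
    by (rule emeasure_cball_eq_measure[OF fN])
  have qp_low: "ennreal (1 / C * measure P (cball x (\<alpha> * r)) - measure N (cball x r)) \<le> qp (cball x r)"
    if "r > 0" for x r
    using qp_lower[OF that, of x, folded P_def N_def] unfolding eP eN
    by (rule ennreal_le_of_ereal_diff_le) auto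
  have qn_low: "ennreal (1 / C * measure N (cball x (\<alpha> * r)) - measure P (cball x r)) \<le> qn (cball x r)"
    if "r > 0" for x r
    using qn_lower[OF that, of x, folded P_def N_def] unfolding eP eN
    by (rule ennreal_le_of_ereal_diff_le) auto
  interpret p: packing_comparison P qp C "1 / (\<gamma> * C)"
  proof
    show "ennreal (1 / (\<gamma> * C)) * emeasure P U \<le> packing_open qp U" if "open U" for U
      by (rule packing_open_lower[OF separable dir_limited nu alpha gamma sP fP sN fN S C qp_low that])
  qed (use sP fP qp_upper gamma C in \<open>auto simp: P_def\<close>)
  interpret n: packing_comparison N qn C "1 / (\<gamma> * C)"
  proof
    show "ennreal (1 / (\<gamma> * C)) * emeasure N U \<le> packing_open qn U" if "open U" for U
      by (rule packing_open_lower[OF separable dir_limited nu alpha gamma sN fN sP fP S' C qn_low that])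
  qed (use sN fN qn_upper gamma C in \<open>auto simp: N_def\<close>)
  obtain MP where MP: "sets MP = sets borel" "\<And>A. A \<in> sets borel \<Longrightarrow> emeasure MP A = packing_measure qp A"
    by (rule p.packing_measure_borel) blast
  obtain MN where MN: "sets MN = sets borel" "\<And>A. A \<in> sets borel \<Longrightarrow> emeasure MN A = packing_measure qn A"
    by (rule n.packing_measure_borel) blast
  have finM: "emeasure MP UNIV < \<infinity> \<or> emeasure MN UNIV < \<infinity>"
    using fin le_less_trans[OF p.packing_measure_le[of UNIV]] le_less_trans[OF n.packing_measure_le[of UNIV]]
    by (auto simp: MP(2) MN(2) ennreal_mult_less_top)
  have hat: "\<mu>hat A = enn2ereal (emeasure MP A) - enn2ereal (emeasure MN A)" if "A \<in> sets borel" for A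
    using that by (simp add: \<mu>hat_def MP(2) MN(2))
  have signed: "signed_borel_measure \<mu>hat"
    by (rule signed_borel_measure_diff[OF MP(1) MN(1) finM hat])
  \<comment> \<open>The upper bounds carry null sets over, so \<open>S\<close> is a Hahn set for
    \<open>\<mu>hat\<close> too. By uniqueness its variations are the two packing measures on Borel
    sets, and the bounds for the total variation result by addition.\<close>
  have "emeasure MP (- S) = 0" "emeasure MN S = 0"
    using p.packing_measure_le[OF S'(1)] n.packing_measure_le[OF S(1)] S S'
    by (simp_all add: MP(2) MN(2))
  then have "jordan_decomposition \<mu>hat MP MN"
    using MP(1) MN(1) S(1) finM hat unfolding jordan_decomposition_def by blast
  note var = jordan_decomposition_variations[OF this]
  have tv_hat: "total_variation \<mu>hat A = packing_measure qp A + packing_measure qn A" if "A \<in> sets borel" for A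
    using that by (simp add: total_variation_def var MP(2) MN(2))
  have tv: "total_variation \<mu> A = emeasure P A + emeasure N A" for A
    by (simp add: total_variation_def P_def N_def)
  have tv_ge: "ennreal (1 / (\<gamma> * C)) * total_variation \<mu> A \<le> total_variation \<mu>hat A" if "A \<in> sets borel" for A
    unfolding tv_hat[OF that] tv distrib_left
    by (intro add_mono p.packing_measure_ge n.packing_measure_ge that)
  have tv_le: "total_variation \<mu>hat A \<le> ennreal C * total_variation \<mu> A" if "A \<in> sets borel" for A
    unfolding tv_hat[OF that] tv distrib_left
    by (intro add_mono p.packing_measure_le n.packing_measure_le that)
  show ?thesis
    unfolding P_def[symmetric] N_def[symmetric]
    by (intro conjI allI ballI impI p.metric_outer_measure_packing n.metric_outer_measure_packing
        p.packing_measure_bounded n.packing_measure_bounded signed tv_ge tv_le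
        p.packing_measure_le p.packing_measure_ge n.packing_measure_le n.packing_measure_ge)
qed

end
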